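(* Let $A$ be a finite set and let $((X_i)_{i\in\mathbb{Z}},\mathbb{P})$ be a stationary process on $A$ that is a uniform martingale. Then $((X_i)_{i\in\mathbb{Z}},\mathbb{P})$ is a deterministic random-step Markov process, and furthermore it has a representation as a complete random-step Markov process with finite expected look-back distance if and only if $\sum_{n}\operatorname{var}_n(\mathbb{P})<\infty$.
   Context: Notation: $\mathbb{Z}^+=\{1,2,\dots\}$, $\mathbb{Z}^-=\{-1,-2,\dots\}$. All subsets of $A$ are measurable. $(X_i)_{i=-n}^{-1}=(\omega_i)_{i=-n}^{-1}$ abbreviates $X_{-1}=\omega_{-1},\dots,X_{-n}=\omega_{-n}$, and similarly for infinite pasts $(X_i)_{i<0}=(\omega_i)_{i<0}$. Conditional probabilities are only defined up to null sets, and conditions on them quantified over $\omega$ are understood for almost every $\omega$ (suprema over pasts being understood accordingly). Complete random-step Markov process: Given a stationary process $((X_i)_{i\in\mathbb{Z}},\mathbb{P})$ on $A$, a representation of it as a complete random-step Markov process consists of an independent stationary process $(L_i)_{i\in\mathbb{Z}}$ with values in $\mathbb{Z}^+$ (the $L_i$, called look-back distances, are independent and identically distributed) and a stationary coupling $\hat{\mathbb{P}}$ of $(X_i)_{i\in\mathbb{Z}}$ and $(L_i)_{i\in\mathbb{Z}}$ such that $L_0$ is independent of $\{X_i: i<0\}$ and, for every $n\in\mathbb{Z}^+$, $\omega\in A^{\mathbb{Z}}$ and measurable $E_0\subseteq A$, $$\hat{\mathbb{P}}\big(X_0\in E_0\mid (X_i)_{i=-n}^{-1}=(\omega_i)_{i=-n}^{-1}\wedge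 L_0=n\big)=\hat{\mathbb{P}}\big(X_0\in E_0\mid (X_i)_{i<0}=(\omega_i)_{i<0}\wedge L_0=n\big).$$ A process having such a representation is called a random-step Markov process (or random Markov process). The representation has finite expected look-back distance if $\hat{\mathbb{E}}(L_0)<\infty$. Deterministic random-step Markov process: a random-step Markov process on a countable (here finite) alphabet having a representation $((X_i,L_i)_{i\in\mathbb{Z}},\hat{\mathbb{P}})$ as a complete random-step Markov process such that for every $n$ and every sequence $(\omega_i)_{i\le 0}$, $$\hat{\mathbb{P}}\big(X_0=\omega_0\mid (X_i)_{i<0}=(\omega_i)_{i<0}\wedge L_0=n\big)=\hat{\mathbb{P}}\big(X_0=\omega_0\mid (X_i)_{i=-n}^{-1}=(\omega_i)_{i=-n}^{-1}\wedge L_0=n\big)\in\{0,1\}.$$ Uniform martingale: a stationary process on $A$ such that for every $\varepsilon>0$ there is $n_\varepsilon$ such that for every $n\ge n_\varepsilon$ and every $(\omega_i)_{i<0}\in A^{\mathbb{Z}^-}$, $$\big\|\mathbb{P}(X_0\in\cdot\mid (X_i)_{i<0}=(\omega_i)_{i<0})-\mathbb{P}(X_0\in\cdot\mid (X_i)_{i=-n}^{-1}=(\omega_i)_{i=-n}^{-1})\big\|_{TV}<\varepsilon,$$ where $\|\mu-\nu\|_{TV}=\sup_E|\mu(E)-\nu(E)|$ for probability measures. Variation: for $k\ge 0$, $$\operatorname{var}_k(\mathbb{P})=\sup\Big\{\big|\mathbb{P}(X_0=a_0\mid (X_i)_{i=-k}^{-1}=(\omega_i)_{i=-k}^{-1})-\mathbb{P}(X_0=a_0\mid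 (X_i)_{i<0}=(\omega_i)_{i<0})\big| : a_0\in A,\ (\omega_i)_{i\le -1}\in A^{\mathbb{Z}^-}\Big\}.$$ *)

theory Defs
  imports "HOL-Probability.Probability"
begin

text \<open>
  A process is a family \<open>X :: int \<Rightarrow> 'w \<Rightarrow> 's\<close> of random variables on a probability space \<open>M\<close>;
  its law is a measure on the product space over the index set of all integers.
\<close>

definition process_law :: "'w measure \<Rightarrow> 's measure \<Rightarrow> (int \<Rightarrow> 'w \<Rightarrow> 's) \<Rightarrow> (int \<Rightarrow> 's) measure" where
  "process_law M S X = distr M (\<Pi>\<^sub>M i\<in>UNIV. S) (\<lambda>w i. X i w)"

definition stationary_process :: "'w measure \<Rightarrow> 's measure \<Rightarrow> (int \<Rightarrow> 'w \<Rightarrow> 's) \<Rightarrow> bool" where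
  "stationary_process M S X \<longleftrightarrow>
     prob_space M \<and> (\<forall>i. X i \<in> measurable M S) \<and>
     (\<forall>k. process_law M S (\<lambda>i. X (i + k)) = process_law M S X)"

definition block :: "(int \<Rightarrow> 'w \<Rightarrow> 's) \<Rightarrow> int set \<Rightarrow> 'w \<Rightarrow> int \<Rightarrow> 's" where
  "block X J w = (\<lambda>i\<in>J. X i w)"

abbreviation block_space :: "'a set \<Rightarrow> int set \<Rightarrow> (int \<Rightarrow> 'a) measure" where
  "block_space A J \<equiv> \<Pi>\<^sub>M i\<in>J. count_space A"

abbreviation all_past :: "int set" where
  "all_past \<equiv> {..<0}"

abbreviation recent_past :: "nat \<Rightarrow> int set" where
  "recent_past n \<equiv> {- int n..-1}"

text \<open>
  The conditional probability of an event given a random variable \<open>V\<close> is the conditional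
  expectation of its indicator given the sigma-algebra generated by \<open>V\<close>. It is a function of the
  sample point \<open>w\<close>, defined almost everywhere; its value at \<open>w\<close> is the conditional probability given
  that \<open>V\<close> takes the value \<open>V w\<close>. Hence ``for (almost) every past \<open>\<omega>\<close>'' becomes ``for almost every
  \<open>w\<close>'' below.
\<close>

definition cond_prob_given :: "'w measure \<Rightarrow> 'v measure \<Rightarrow> ('w \<Rightarrow> 'v) \<Rightarrow> 'w set \<Rightarrow> 'w \<Rightarrow> real" where
  "cond_prob_given M N V H = real_cond_exp M (vimage_algebra (space M) V N) (indicator H)"

definition cond_law ::
    "'w measure \<Rightarrow> 'a set \<Rightarrow> (int \<Rightarrow> 'w \<Rightarrow> 'a) \<Rightarrow> int set \<Rightarrow> 'w \<Rightarrow> 'a set \<Rightarrow> real" where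
  "cond_law M A X J w E =
     cond_prob_given M (block_space A J) (block X J) {v \<in> space M. X 0 v \<in> E} w"

definition tv_dist :: "'a set \<Rightarrow> ('a set \<Rightarrow> real) \<Rightarrow> ('a set \<Rightarrow> real) \<Rightarrow> real" where
  "tv_dist A \<mu> \<nu> = (SUP E\<in>Pow A. \<bar>\<mu> E - \<nu> E\<bar>)"

definition uniform_martingale :: "'w measure \<Rightarrow> 'a set \<Rightarrow> (int \<Rightarrow> 'w \<Rightarrow> 'a) \<Rightarrow> bool" where
  "uniform_martingale M A X \<longleftrightarrow>
     stationary_process M (count_space A) X \<and>
     (\<forall>\<epsilon>>0. \<exists>n0. \<forall>n\<ge>n0. AE w in M.
        tv_dist A (cond_law M A X all_past w) (cond_law M A X (recent_past n) w) < \<epsilon>)"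

definition variation :: "'w measure \<Rightarrow> 'a set \<Rightarrow> (int \<Rightarrow> 'w \<Rightarrow> 'a) \<Rightarrow> nat \<Rightarrow> ennreal" where
  "variation M A X k =
     (SUP a\<in>A. esssup M (\<lambda>w. ennreal
        \<bar>cond_law M A X (recent_past k) w {a} - cond_law M A X all_past w {a}\<bar>))"

text \<open>
  Conditional law of \<open>Y 0\<close> given the block \<open>Y\<restriction>J\<close> and \<open>L 0\<close> jointly: at a sample point with
  \<open>L 0 w = n\<close> it is the conditional law given the block and \<open>L 0 = n\<close>.
\<close>

definition cond_law_lookback ::
    "'w measure \<Rightarrow> 'a set \<Rightarrow> (int \<Rightarrow> 'w \<Rightarrow> 'a) \<Rightarrow> (int \<Rightarrow> 'w \<Rightarrow> nat) \<Rightarrow> int set \<Rightarrow> 'w \<Rightarrow> 'a set \<Rightarrow> real"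
  where
  "cond_law_lookback Q A Y L J w E =
     cond_prob_given Q (block_space A J \<Otimes>\<^sub>M count_space {1..}) (\<lambda>v. (block Y J v, L 0 v))
       {v \<in> space Q. Y 0 v \<in> E} w"

definition complete_rsm_representation ::
    "'w measure \<Rightarrow> 'a set \<Rightarrow> (int \<Rightarrow> 'w \<Rightarrow> 'a) \<Rightarrow>
     'v measure \<Rightarrow> (int \<Rightarrow> 'v \<Rightarrow> 'a) \<Rightarrow> (int \<Rightarrow> 'v \<Rightarrow> nat) \<Rightarrow> bool" where
  "complete_rsm_representation M A X Q Y L \<longleftrightarrow>
     stationary_process M (count_space A) X \<and>
     stationary_process Q (count_space A \<Otimes>\<^sub>M count_space {1..}) (\<lambda>i v. (Y i v, L i v)) \<and>
     process_law Q (count_space A) Y = process_law M (count_space A) X \<and>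
     prob_space.indep_vars Q (\<lambda>_. count_space {1..}) L UNIV \<and>
     prob_space.indep_set Q
       (sets (vimage_algebra (space Q) (L 0) (count_space {1..})))
       (sets (vimage_algebra (space Q) (block Y all_past) (block_space A all_past))) \<and>
     (\<forall>n\<ge>1. \<forall>E\<subseteq>A. AE v in Q. L 0 v = n \<longrightarrow>
        cond_law_lookback Q A Y L (recent_past n) v E = cond_law_lookback Q A Y L all_past v E)"

definition deterministic_representation ::
    "'w measure \<Rightarrow> 'a set \<Rightarrow> (int \<Rightarrow> 'w \<Rightarrow> 'a) \<Rightarrow>
     'v measure \<Rightarrow> (int \<Rightarrow> 'v \<Rightarrow> 'a) \<Rightarrow> (int \<Rightarrow> 'v \<Rightarrow> nat) \<Rightarrow> bool" where
  "deterministic_representation M A X Q Y L \<longleftrightarrow>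
     complete_rsm_representation M A X Q Y L \<and>
     (\<forall>n\<ge>1. \<forall>a\<in>A. AE v in Q. L 0 v = n \<longrightarrow>
        cond_law_lookback Q A Y L all_past v {a} = cond_law_lookback Q A Y L (recent_past n) v {a} \<and>
        cond_law_lookback Q A Y L (recent_past n) v {a} \<in> {0, 1})"

definition finite_expected_lookback :: "'v measure \<Rightarrow> (int \<Rightarrow> 'v \<Rightarrow> nat) \<Rightarrow> bool" where
  "finite_expected_lookback Q L \<longleftrightarrow> (\<integral>\<^sup>+ v. of_nat (L 0 v) \<partial>Q) < \<infinity>"

text \<open>
  A representation only involves the joint law of \<open>(Y, L)\<close>, so a representation on any probability
  space can be pushed forward to the space of pairs of paths. The existential quantifiers below
  therefore range over measures on that type without loss of generality.
\<close>

type_synonym 'a coupling_space = "(int \<Rightarrow> 'a) \<times> (int \<Rightarrow> nat)"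

definition deterministic_random_step_markov ::
    "'w measure \<Rightarrow> 'a set \<Rightarrow> (int \<Rightarrow> 'w \<Rightarrow> 'a) \<Rightarrow> bool" where
  "deterministic_random_step_markov M A X \<longleftrightarrow>
     (\<exists>(Q :: 'a coupling_space measure) Y L. deterministic_representation M A X Q Y L)"

definition has_finite_expected_lookback_representation ::
    "'w measure \<Rightarrow> 'a set \<Rightarrow> (int \<Rightarrow> 'w \<Rightarrow> 'a) \<Rightarrow> bool" where
  "has_finite_expected_lookback_representation M A X \<longleftrightarrow>
     (\<exists>(Q :: 'a coupling_space measure) Y L.
        complete_rsm_representation M A X Q Y L \<and> finite_expected_lookback Q L)"

end

theory Submission
  imports Defs
begin

text \<open>
  If the look-back distance has tail \<open>T\<close> in some representation, the event \<open>X 0 = a\<close> splits into the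
  parts \<open>L 0 = n\<close> with \<open>n \<le> k\<close>, whose conditional probabilities given the whole past already depend
  on the last \<open>k\<close> letters only, and a part of conditional probability at most \<open>T k\<close>. Hence the \<open>k\<close>-th
  variation is at most \<open>T k\<close>, and \<open>T\<close> sums to the expected look-back distance.

  Conversely, split the mass of the conditional law of \<open>X 0\<close> greedily: at stage \<open>n\<close>, a mass \<open>q n\<close> goes to
  the letter \<open>f n\<close> that, judging from the last \<open>n\<close> letters, has the largest mass left. If \<open>R n\<close> is the
  total mass left, this letter has at least \<open>R n / card A - v n\<close> left, where \<open>v n\<close> is the variation; so
  \<open>q n\<close> may be this amount whenever it is positive, which gives
  \<open>R (n + 1) = min (R n) ((1 - 1 / card A) * R n + v n)\<close>. Then \<open>R\<close> tends to \<open>0\<close>, and it is summable if \<open>v\<close>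
  is. In the limit the conditional probability of \<open>a\<close> is the sum of the \<open>q n\<close> with \<open>f n = a\<close>. The coupling
  draws each \<open>L i\<close>, given the path, with weights proportional to \<open>q n\<close> on those \<open>n\<close> for which \<open>f n\<close>
  predicts \<open>X i\<close> correctly.
\<close>

section \<open>Conditional laws and path laws\<close>

lemma (in prob_space) sigma_finite_subalgebra_vimage:
  assumes "V \<in> measurable M N"
  shows "sigma_finite_subalgebra M (vimage_algebra (space M) V N)"
proof -
  have "subalgebra M (vimage_algebra (space M) V N)"
    using assms by (auto simp: subalgebra_def measurable_iff_sets)
  then interpret finite_measure_subalgebra M "vimage_algebra (space M) V N"
    by unfold_locales
  show ?thesis ..
qed

text \<open>Every event of the pulled-back algebra is the preimage of an event of \<open>F\<close>,
  so a change of variables shows that the right-hand side has the integrals that characterise the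
  conditional expectation on the left.\<close>

lemma real_cond_exp_distr:
  fixes g :: "'b \<Rightarrow> real"
  assumes "prob_space M" and T[measurable]: "T \<in> measurable M N" and F: "subalgebra N F"
    and g: "integrable (distr M N T) g"
  shows "AE w in M. real_cond_exp M (vimage_algebra (space M) T F) (\<lambda>w. g (T w)) w
            = real_cond_exp (distr M N T) F g (T w)"
proof -
  interpret M: prob_space M by fact
  interpret D: prob_space "distr M N T" by (rule M.prob_space_distr) fact
  have F': "subalgebra (distr M N T) F" using F by (simp add: subalgebra_def)
  then interpret D: finite_measure_subalgebra "distr M N T" F by unfold_locales
  have TF: "T \<in> measurable M F"
    using T F by (auto simp: measurable_def subalgebra_def)
  interpret V: sigma_finite_subalgebra M "vimage_algebra (space M) T F"
    by (rule M.sigma_finite_subalgebra_vimage[OF TF])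
  have [measurable]: "g \<in> borel_measurable N"
    using borel_measurable_integrable[OF g] by simp
  let ?e = "real_cond_exp (distr M N T) F g"
  have [measurable]: "?e \<in> borel_measurable N"
    using borel_measurable_cond_exp2[of "distr M N T" F g] by simp
  have eF: "?e \<in> borel_measurable F" by simp
  have ei: "integrable (distr M N T) ?e" by (rule D.real_cond_exp_int(1)[OF g])
  show ?thesis
  proof (rule V.real_cond_exp_charact)
    fix B assume "B \<in> sets (vimage_algebra (space M) T F)"
    then obtain C where C: "C \<in> sets F" "B = T -` C \<inter> space M"
      using TF by (auto simp: sets_vimage_algebra2 measurable_def)
    have CN[measurable]: "C \<in> sets N" using C F by (auto simp: subalgebra_def)
    have *: "(\<integral>x\<in>B. h (T x) \<partial>M) = (\<integral>x\<in>C. h x \<partial>distr M N T)"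
      if [measurable]: "h \<in> borel_measurable N" for h :: "'b \<Rightarrow> real"
      unfolding set_lebesgue_integral_def
      by (subst integral_distr) (auto intro!: Bochner_Integration.integral_cong simp: C indicator_def)
    show "(\<integral>x\<in>B. g (T x) \<partial>M) = (\<integral>x\<in>B. ?e (T x) \<partial>M)"
      by (simp add: * D.real_cond_exp_intA[OF g C(1)])
  next
    show "integrable M (\<lambda>w. g (T w))" "integrable M (\<lambda>w. ?e (T w))"
      using g ei by (auto simp: integrable_distr_eq)
    show "(\<lambda>w. ?e (T w)) \<in> borel_measurable (vimage_algebra (space M) T F)"
      using TF by (intro measurable_compose[OF measurable_vimage_algebra1 eF]) (simp add: measurable_def)
  qed
qed

text \<open>The Doob-Dynkin factorisation, obtained by building \<open>f\<close> up from indicators.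
  It makes it possible to evaluate a conditional probability given a block and a look-back distance
  at a prescribed distance.\<close>

lemma borel_measurable_vimage_algebra_factor:
  fixes f :: "'a \<Rightarrow> ennreal"
  assumes V: "V \<in> \<Omega> \<rightarrow> space N" and f: "f \<in> borel_measurable (vimage_algebra \<Omega> V N)"
  obtains g where "g \<in> borel_measurable N" "\<And>w. w \<in> \<Omega> \<Longrightarrow> f w = g (V w)"
proof -
  define P where "P f g \<longleftrightarrow> g \<in> borel_measurable N \<and> (\<forall>w\<in>\<Omega>. f w = g (V w))" for f :: "'a \<Rightarrow> ennreal" and g
  have "\<exists>g. P f g"
    using f
  proof (induction rule: borel_measurable_induct)
    case (cong f1 f2)
    then show ?case by (simp add: P_def)
  next
    case (set B)
    then obtain C where "C \<in> sets N" "B = V -` C \<inter> \<Omega>"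
      using V by (auto simp: sets_vimage_algebra2)
    then have "P (indicator B) (indicator C)" by (simp add: P_def indicator_def)
    then show ?case by blast
  next
    case (mult u c)
    from mult.IH obtain g where "P u g" ..
    then have "P (\<lambda>x. c * u x) (\<lambda>x. c * g x)" by (auto simp: P_def)
    then show ?case by blast
  next
    case (add u v)
    from add.IH obtain g h where "P u g" "P v h" by metis
    then have "P (\<lambda>x. v x + u x) (\<lambda>x. h x + g x)" by (auto simp: P_def)
    then show ?case by blast
  next
    case (seq U)
    from seq.IH have "\<forall>i. \<exists>g. P (U i) g" by blast
    then obtain g where "\<forall>i. P (U i) (g i)" by (rule choice[THEN exE])
    then have "P (SUP i. U i) (\<lambda>x. SUP i. g i x)" by (auto simp: P_def image_comp intro!: borel_measurable_SUP)
    then show ?case by blast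
  qed
  then show thesis using that by (auto simp: P_def)
qed

lemma measurable_block:
  assumes "\<And>i. X i \<in> measurable M (count_space A)"
  shows "block X J \<in> measurable M (block_space A J)"
  unfolding block_def[abs_def] using assms by (intro measurable_restrict)

lemma measurable_path:
  assumes "\<And>i. X i \<in> measurable M S"
  shows "(\<lambda>w i. X i w) \<in> measurable M (\<Pi>\<^sub>M i\<in>UNIV. S)"
  using measurable_restrict[of UNIV X M "\<lambda>_. S"] assms by (simp add: restrict_UNIV)

lemma prob_space_process_law:
  assumes "prob_space M" "\<And>i. X i \<in> measurable M S"
  shows "prob_space (process_law M S X)"
  unfolding process_law_def using assms by (intro prob_space.prob_space_distr measurable_path)

text \<open>The block map of \<open>X\<close> is the path map followed by the block map of the
  coordinate process, so conditional laws depend on the process only through its path law.\<close>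

lemma cond_law_process_law:
  fixes X :: "int \<Rightarrow> 'w \<Rightarrow> 'a"
  assumes "prob_space M" and X[measurable]: "\<And>i. X i \<in> measurable M (count_space A)"
  shows "AE w in M. cond_law M A X J w E =
    cond_law (process_law M (count_space A) X) A (\<lambda>i \<omega>. \<omega> i) J (\<lambda>i. X i w) E"
proof -
  let ?S = "\<Pi>\<^sub>M i\<in>(UNIV::int set). count_space A"
  let ?T = "\<lambda>w i. X i w"
  let ?Z = "\<lambda>i (\<omega>::int \<Rightarrow> 'a). \<omega> i"
  have T[measurable]: "?T \<in> measurable M ?S" by (rule measurable_path[OF X])
  have Z[measurable]: "?Z i \<in> measurable ?S (count_space A)" for i by simp
  have Tsp: "?T \<in> space M \<rightarrow> space ?S" using T by (auto simp: measurable_def)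
  have Bsp: "block ?Z J \<in> space ?S \<rightarrow> space (block_space A J)"
    using measurable_block[of ?Z ?S A J, OF Z] by (auto simp: measurable_def)
  let ?F = "vimage_algebra (space ?S) (block ?Z J) (block_space A J)"
  have "sigma_finite_subalgebra (distr M ?S ?T) (vimage_algebra (space (distr M ?S ?T)) (block ?Z J) (block_space A J))"
    by (intro prob_space.sigma_finite_subalgebra_vimage prob_space.prob_space_distr assms measurable_block) auto
  then have F: "subalgebra ?S ?F"
    by (simp add: sigma_finite_subalgebra_def subalgebra_def)
  interpret D: prob_space "distr M ?S ?T" by (intro prob_space.prob_space_distr assms T)
  let ?H = "{\<omega> \<in> space ?S. \<omega> 0 \<in> E}"
  have "?H = ?Z 0 -` (E \<inter> A) \<inter> space ?S"
    by (auto simp: space_PiM PiE_iff)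
  then have H: "?H \<in> sets ?S" using measurable_sets[OF Z[of 0], of "E \<inter> A"] by simp
  have "AE w in M. real_cond_exp M (vimage_algebra (space M) ?T ?F) (\<lambda>w. indicator ?H (?T w)) w
     = real_cond_exp (distr M ?S ?T) ?F (indicator ?H) (?T w)"
    by (rule real_cond_exp_distr[OF assms(1) T F]) (use H in \<open>auto intro!: integrable_real_indicator simp: D.emeasure_eq_measure\<close>)
  moreover have "vimage_algebra (space M) ?T ?F = vimage_algebra (space M) (block X J) (block_space A J)"
    using vimage_algebra_vimage_algebra_eq[OF Tsp Bsp] by (simp add: block_def[abs_def])
  moreover have "AE w in M. real_cond_exp M (vimage_algebra (space M) (block X J) (block_space A J)) (\<lambda>w. indicator ?H (?T w)) w =
    real_cond_exp M (vimage_algebra (space M) (block X J) (block_space A J)) (indicator {w\<in>space M. X 0 w \<in> E}) w"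
  proof (intro sigma_finite_subalgebra.real_cond_exp_cong[OF prob_space.sigma_finite_subalgebra_vimage])
    show "(\<lambda>w. indicat_real ?H (\<lambda>i. X i w)) \<in> borel_measurable M" using H by (intro measurable_compose[OF T]) simp
    have "{w\<in>space M. X 0 w \<in> E} = ?T -` ?H \<inter> space M" using Tsp by auto
    then have "{w\<in>space M. X 0 w \<in> E} \<in> sets M" using H T by (auto intro!: measurable_sets)
    then show "indicat_real {w\<in>space M. X 0 w \<in> E} \<in> borel_measurable M" by simp
    show "AE x in M. indicat_real ?H (\<lambda>i. X i x) = indicat_real {w\<in>space M. X 0 w \<in> E} x"
      using Tsp by (intro AE_I2) (auto simp: indicator_def)
  qed (use assms(1) measurable_block[of X, OF X] in auto)
  ultimately show ?thesis
    by (auto simp: cond_law_def cond_prob_given_def process_law_def)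
qed

lemma subalgebra_block:
  fixes Y :: "int \<Rightarrow> 'v \<Rightarrow> 'a"
  assumes Y: "\<And>i. Y i \<in> measurable Q (count_space A)" and "J \<subseteq> J'"
  shows "subalgebra (vimage_algebra (space Q) (block Y J') (block_space A J'))
    (vimage_algebra (space Q) (block Y J) (block_space A J))"
proof -
  let ?F = "vimage_algebra (space Q) (block Y J') (block_space A J')"
  have "block Y J' \<in> measurable ?F (block_space A J')"
    using measurable_block[of Y, OF Y] by (intro measurable_vimage_algebra1) (auto simp: measurable_def)
  from measurable_compose[OF this measurable_restrict_subset[OF assms(2)]]
  have "(\<lambda>w. restrict (block Y J' w) J) \<in> measurable ?F (block_space A J)" by simp
  also have "(\<lambda>w. restrict (block Y J' w) J) = block Y J"
    using assms(2) by (auto simp: block_def fun_eq_iff restrict_def)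
  finally have "sets (vimage_algebra (space ?F) (block Y J) (block_space A J)) \<subseteq> sets ?F"
    unfolding measurable_iff_sets by blast
  then show ?thesis by (simp add: subalgebra_def)
qed

lemma stationary_process_pairD:
  assumes "stationary_process Q (S \<Otimes>\<^sub>M T) (\<lambda>i v. (Y i v, L i v))"
  shows "prob_space Q" "Y i \<in> measurable Q S" "L i \<in> measurable Q T"
proof -
  have *: "(\<lambda>v. (Y i v, L i v)) \<in> measurable Q (S \<Otimes>\<^sub>M T)" "prob_space Q"
    using assms by (auto simp: stationary_process_def)
  show "prob_space Q" by fact
  show "Y i \<in> measurable Q S" using measurable_compose[OF *(1) measurable_fst] by simp
  show "L i \<in> measurable Q T" using measurable_compose[OF *(1) measurable_snd] by simp
qed

text \<open>By independence the constant \<open>prob D\<close> has the right integral over every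
  event of \<open>F\<close>.\<close>

lemma (in prob_space) real_cond_exp_indicator_indep:
  assumes F: "subalgebra M F" and D: "D \<in> events"
    and indep: "\<And>B. B \<in> sets F \<Longrightarrow> prob (D \<inter> B) = prob D * prob B"
  shows "AE w in M. real_cond_exp M F (indicator D) w = prob D"
proof -
  interpret finite_measure_subalgebra M F by unfold_locales (rule F)
  show ?thesis
  proof (rule real_cond_exp_charact)
    fix B assume B: "B \<in> sets F"
    then have "B \<in> events" using F by (auto simp: subalgebra_def)
    moreover have "indicat_real B w *\<^sub>R indicat_real D w = indicator (D \<inter> B) w" for w
      by (auto simp: indicator_def)
    ultimately show "(\<integral>w\<in>B. indicator D w \<partial>M) = (\<integral>w\<in>B. prob D \<partial>M)"
      using D indep[OF B] by (simp add: set_lebesgue_integral_def)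
  qed (use D in \<open>auto intro!: integrable_real_indicator simp: emeasure_eq_measure\<close>)
qed

section \<open>Variation and look-back distance\<close>

text \<open>Both conditional probabilities are split along the value of \<open>L 0\<close>. The
  parts with value at most \<open>k\<close> agree, and each of the two remainders lies between 0 and
  the conditional probability of \<open>K\<close>, which is constant by independence.\<close>

lemma cond_law_diff_le_lookback_tail:
  assumes rep: "complete_rsm_representation M A X Q Y L" and E: "E \<subseteq> A"
  shows "AE v in Q. \<bar>cond_law Q A Y (recent_past k) v E - cond_law Q A Y all_past v E\<bar>
    \<le> measure Q {v \<in> space Q. k < L 0 v}"
proof -
  note st = rep[unfolded complete_rsm_representation_def, THEN conjunct2, THEN conjunct1]
  interpret Q: prob_space Q by (rule stationary_process_pairD[OF st])
  have Y[measurable]: "\<And>i. Y i \<in> measurable Q (count_space A)"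
    and L[measurable]: "\<And>i. L i \<in> measurable Q (count_space {1..})"
    using stationary_process_pairD[OF st] by auto
  have [measurable]: "L i \<in> measurable Q (count_space UNIV)" for i
    using measurable_compose[OF L, of "\<lambda>x. x" "count_space UNIV"] by simp
  note bl = measurable_block[of Y Q A, OF Y]
  have L1: "1 \<le> L 0 v" if "v \<in> space Q" for v
    using measurable_space[OF L that, of 0] by simp
  \<comment> \<open>\<open>F J\<close> describes the letters of the block, \<open>G J\<close> in
    addition the value of \<open>L 0\<close>. The representation property concerns \<open>G\<close>,
    the claim concerns \<open>F\<close>; the tower property leads from one to the other.\<close>
  define F where "F J = vimage_algebra (space Q) (block Y J) (block_space A J)" for J
  define G where "G J = vimage_algebra (space Q) (\<lambda>v. (block Y J v, L 0 v)) (block_space A J \<Otimes>\<^sub>M count_space {1..})" for J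
  define H where "H = {v \<in> space Q. Y 0 v \<in> E}"
  define D where "D n = {v \<in> space Q. L 0 v = n}" for n
  define K where "K = {v \<in> space Q. k < L 0 v}"
  have pm: "(\<lambda>v. (block Y J v, L 0 v)) \<in> measurable Q (block_space A J \<Otimes>\<^sub>M count_space {1..})" for J
    by (rule measurable_Pair[OF bl L])
  have pG: "(\<lambda>v. (block Y J v, L 0 v)) \<in> measurable (G J) (block_space A J \<Otimes>\<^sub>M count_space {1..})" for J
    using pm[of J] unfolding G_def by (intro measurable_vimage_algebra1) (auto simp: measurable_def)
  have bG: "block Y J \<in> measurable (G J) (block_space A J)" and LG: "L 0 \<in> measurable (G J) (count_space {1..})" for J
    using measurable_compose[OF pG measurable_fst] measurable_compose[OF pG measurable_snd] by auto
  have bF: "block Y J \<in> measurable (F J) (block_space A J)" for J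
    using bl[of J] unfolding F_def by (intro measurable_vimage_algebra1) (auto simp: measurable_def)
  have sF: "sigma_finite_subalgebra Q (F J)" and sG: "sigma_finite_subalgebra Q (G J)" for J
    unfolding F_def G_def by (intro Q.sigma_finite_subalgebra_vimage bl pm)+
  have QF: "subalgebra Q (F J)" and QG: "subalgebra Q (G J)" for J
    using sF sG by (auto simp: sigma_finite_subalgebra_def)
  have FF: "subalgebra (F J') (F J)" if "J \<subseteq> J'" for J J'
    using subalgebra_block[of Y Q A, OF Y that] by (simp add: F_def)
  have GF: "subalgebra (G J) (F J)" for J
    using bG[of J] by (auto simp: subalgebra_def F_def measurable_iff_sets G_def)
  have Hm[measurable]: "H \<in> sets Q"
  proof -
    have "H = Y 0 -` E \<inter> space Q" by (auto simp: H_def)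
    then show ?thesis using measurable_sets[OF Y[of 0], of E] E by simp
  qed
  have Dm[measurable]: "D n \<in> sets Q" and Km[measurable]: "K \<in> sets Q" for n
    unfolding D_def K_def by measurable
  have int[simp]: "integrable Q (indicat_real B)" if "B \<in> sets Q" for B
    using that by (auto intro!: integrable_real_indicator simp: Q.emeasure_eq_measure)
  have ind: "Q.prob ({v\<in>space Q. L 0 v \<in> S} \<inter> B) = Q.prob {v\<in>space Q. L 0 v \<in> S} * Q.prob B"
    if "B \<in> sets (F all_past)" for S B
  proof -
    have "L 0 -` (S \<inter> {1..}) \<inter> space Q \<in> sets (vimage_algebra (space Q) (L 0) (count_space {1..}))"
      by (intro in_vimage_algebra) auto
    also have "L 0 -` (S \<inter> {1..}) \<inter> space Q = {v\<in>space Q. L 0 v \<in> S}" using L1 by auto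
    finally show ?thesis
      using rep that unfolding complete_rsm_representation_def F_def by (auto dest!: Q.indep_setD)
  qed
  have cD: "AE v in Q. real_cond_exp Q (F all_past) (indicator (D n)) v = Q.prob (D n)" for n
    by (rule Q.real_cond_exp_indicator_indep[OF QF]) (use ind[of _ "{n}"] in \<open>simp_all add: D_def\<close>)
  have cK: "AE v in Q. real_cond_exp Q (F J) (indicator K) v = Q.prob K" if "J \<subseteq> all_past" for J
    by (rule Q.real_cond_exp_indicator_indep[OF QF])
      (use ind[of _ "{k<..}"] FF[OF that] in \<open>auto simp add: K_def subalgebra_def\<close>)
  have recent: "recent_past n \<subseteq> recent_past m" "recent_past n \<subseteq> all_past" if "n \<le> m" for n m
    using that by auto
  have part: "AE v in Q. real_cond_exp Q (F all_past) (indicator (D n \<inter> H)) v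
      = real_cond_exp Q (F (recent_past k)) (indicator (D n \<inter> H)) v" if n: "n \<in> {1..k}" for n
  proof -
    let ?R = "recent_past n"
    let ?U = "\<lambda>J. real_cond_exp Q (G J) (indicator H)"
    have UG: "?U J \<in> borel_measurable (G J)" for J by simp
    have "(\<lambda>v. ennreal (?U ?R v)) \<in> borel_measurable (G ?R)" by simp
    then obtain g where g: "g \<in> borel_measurable (block_space A ?R \<Otimes>\<^sub>M count_space {1..})"
      "\<And>v. v \<in> space Q \<Longrightarrow> ennreal (?U ?R v) = g (block Y ?R v, L 0 v)"
      unfolding G_def using pm[of ?R, THEN measurable_space]
      by (elim borel_measurable_vimage_algebra_factor[rotated]) auto
    \<comment> \<open>The factor \<open>g\<close> is evaluated at the fixed value \<open>n\<close>
      instead of \<open>L 0 v\<close>, so that \<open>c\<close> depends on the last \<open>n\<close>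
      letters only. The truncation makes \<open>c\<close> bounded everywhere, whereas conditional
      probabilities are bounded only almost everywhere.\<close>
    define c where "c v = min 1 (enn2real (g (block Y ?R v, n)))" for v
    have cF: "c \<in> borel_measurable (F ?R)"
    proof -
      have "(\<lambda>v. (block Y ?R v, n)) \<in> measurable (F ?R) (block_space A ?R \<Otimes>\<^sub>M count_space {1..})"
        using n by (intro measurable_Pair bF) auto
      then have "(\<lambda>v. g (block Y ?R v, n)) \<in> borel_measurable (F ?R)"
        by (rule measurable_compose[OF _ g(1)])
      then show ?thesis unfolding c_def by simp
    qed
    have cFa: "c \<in> borel_measurable (F all_past)" and cFk: "c \<in> borel_measurable (F (recent_past k))"
      using n by (auto intro!: measurable_from_subalg[OF FF cF])
    have cQ[measurable]: "c \<in> borel_measurable Q" by (rule measurable_from_subalg[OF QF cF])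
    have c01: "0 \<le> c v" "c v \<le> 1" for v by (auto simp: c_def)
    have ci: "integrable Q (\<lambda>v. c v * indicator B v)" if "B \<in> sets Q" for B
      using c01 that by (intro Q.integrable_const_bound[of _ 1]) (auto simp: indicator_def)
    interpret Ga: sigma_finite_subalgebra Q "G all_past" by (rule sG)
    interpret Gn: sigma_finite_subalgebra Q "G ?R" by (rule sG)
    interpret Fa: sigma_finite_subalgebra Q "F all_past" by (rule sF)
    interpret Fk: sigma_finite_subalgebra Q "F (recent_past k)" by (rule sF)
    have DG: "D n \<in> sets (G J)" for J
    proof -
      have "D n = L 0 -` ({n} \<inter> {1..}) \<inter> space (G J)" using L1 by (auto simp: D_def G_def)
      then show ?thesis using measurable_sets[OF LG[of J], of "{n} \<inter> {1..}"] by simp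
    qed
    have "AE v in Q. L 0 v = n \<longrightarrow> ?U ?R v = ?U all_past v"
      using rep E n unfolding complete_rsm_representation_def cond_law_lookback_def cond_prob_given_def G_def H_def by auto
    moreover have "AE v in Q. 0 \<le> ?U ?R v" "AE v in Q. ?U ?R v \<le> 1"
      by (intro Gn.real_cond_exp_pos Gn.real_cond_exp_le_c; simp)+
    moreover have "AE v in Q. real_cond_exp Q (G all_past) (\<lambda>v. indicator (D n) v * indicator H v) v = indicator (D n) v * ?U all_past v"
      using DG by (intro Ga.real_cond_exp_mult) (auto simp: indicator_inter_arith[symmetric])
    \<comment> \<open>On \<open>D n\<close> the fixed value \<open>n\<close> is the actual look-back
      distance; elsewhere both sides vanish.\<close>
    ultimately have *: "AE v in Q. real_cond_exp Q (G all_past) (indicator (D n \<inter> H)) v = c v * indicator (D n) v"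
      unfolding indicator_inter_arith using AE_space
    proof eventually_elim
      case (elim v)
      then have "enn2real (g (block Y ?R v, L 0 v)) = ?U ?R v" by (simp flip: g(2))
      with elim show ?case by (cases "v \<in> D n") (auto simp: c_def D_def)
    qed
    have "AE v in Q. real_cond_exp Q (F all_past) (real_cond_exp Q (G all_past) (indicator (D n \<inter> H))) v
       = real_cond_exp Q (F all_past) (\<lambda>v. c v * indicator (D n) v) v"
      by (rule Fa.real_cond_exp_cong[OF *]) auto
    moreover have "AE v in Q. real_cond_exp Q (F all_past) (real_cond_exp Q (G all_past) (indicator (D n \<inter> H))) v
       = real_cond_exp Q (F all_past) (indicator (D n \<inter> H)) v"
      by (rule Fa.real_cond_exp_nested_subalg[OF QG GF]) simp
    moreover have "AE v in Q. real_cond_exp Q (F all_past) (\<lambda>v. c v * indicator (D n) v) v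
       = c v * real_cond_exp Q (F all_past) (indicator (D n)) v"
      by (intro Fa.real_cond_exp_mult cFa ci) auto
    \<comment> \<open>\<open>c\<close> depends on the past only and \<open>D n\<close> is
      independent of the past, so conditioning on the past multiplies \<open>c\<close> by the
      probability of \<open>D n\<close>.\<close>
    ultimately have **: "AE v in Q. real_cond_exp Q (F all_past) (indicator (D n \<inter> H)) v = c v * Q.prob (D n)"
      using cD[of n] by eventually_elim simp
    \<comment> \<open>The right-hand side of \<open>**\<close> depends only on the last
      \<open>n <= k\<close> letters, so conditioning once more, on the last \<open>k\<close>
      letters, leaves it unchanged.\<close>
    have "AE v in Q. real_cond_exp Q (F (recent_past k)) (real_cond_exp Q (F all_past) (indicator (D n \<inter> H))) v
       = real_cond_exp Q (F (recent_past k)) (\<lambda>v. c v * Q.prob (D n)) v"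
      by (rule Fk.real_cond_exp_cong[OF **]) auto
    moreover have "AE v in Q. real_cond_exp Q (F (recent_past k)) (real_cond_exp Q (F all_past) (indicator (D n \<inter> H))) v
       = real_cond_exp Q (F (recent_past k)) (indicator (D n \<inter> H)) v"
      by (rule Fk.real_cond_exp_nested_subalg[OF QF FF]) auto
    moreover have "AE v in Q. real_cond_exp Q (F (recent_past k)) (\<lambda>v. c v * Q.prob (D n)) v = c v * Q.prob (D n)"
      using cFk ci[of "space Q"] c01 by (intro Fk.real_cond_exp_F_meas Q.integrable_const_bound[of _ 1]) 
        (auto simp: abs_mult intro!: mult_le_one)
    ultimately show ?thesis using ** by eventually_elim simp
  qed
  have split: "indicat_real H v = (\<Sum>n\<in>{1..k}. indicator (D n \<inter> H) v) + indicator (K \<inter> H) v"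
    if "v \<in> space Q" for v
  proof -
    have "(\<Sum>n\<in>{1..k}. indicat_real (D n \<inter> H) v) = (\<Sum>n\<in>{1..k}. if n = L 0 v then indicator H v else 0)"
      using that by (intro sum.cong) (auto simp: D_def indicator_def)
    then show ?thesis using that L1[OF that] by (auto simp: K_def indicator_def)
  qed
  have cond: "AE v in Q. real_cond_exp Q (F J) (indicator H) v
      = (\<Sum>n\<in>{1..k}. real_cond_exp Q (F J) (indicator (D n \<inter> H)) v) + real_cond_exp Q (F J) (indicator (K \<inter> H)) v"
    "AE v in Q. 0 \<le> real_cond_exp Q (F J) (indicator (K \<inter> H)) v"
    "AE v in Q. real_cond_exp Q (F J) (indicator (K \<inter> H)) v \<le> real_cond_exp Q (F J) (indicator K) v" for J
  proof -
    interpret FJ: sigma_finite_subalgebra Q "F J" by (rule sF)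
    have "AE v in Q. real_cond_exp Q (F J) (indicator H) v
      = real_cond_exp Q (F J) (\<lambda>v. (\<Sum>n\<in>{1..k}. indicator (D n \<inter> H) v) + indicator (K \<inter> H) v) v"
      using split by (intro FJ.real_cond_exp_cong AE_I2) auto
    moreover have "AE v in Q. real_cond_exp Q (F J) (\<lambda>v. (\<Sum>n\<in>{1..k}. indicator (D n \<inter> H) v) + indicator (K \<inter> H) v) v
      = real_cond_exp Q (F J) (\<lambda>v. \<Sum>n\<in>{1..k}. indicator (D n \<inter> H) v) v + real_cond_exp Q (F J) (indicator (K \<inter> H)) v"
      by (intro FJ.real_cond_exp_add Bochner_Integration.integrable_sum int) auto
    moreover have "AE v in Q. real_cond_exp Q (F J) (\<lambda>v. \<Sum>n\<in>{1..k}. indicator (D n \<inter> H) v) v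
      = (\<Sum>n\<in>{1..k}. real_cond_exp Q (F J) (indicator (D n \<inter> H)) v)"
      by (intro FJ.real_cond_exp_sum int) auto
    ultimately show "AE v in Q. real_cond_exp Q (F J) (indicator H) v
      = (\<Sum>n\<in>{1..k}. real_cond_exp Q (F J) (indicator (D n \<inter> H)) v) + real_cond_exp Q (F J) (indicator (K \<inter> H)) v"
      by eventually_elim simp
    show "AE v in Q. 0 \<le> real_cond_exp Q (F J) (indicator (K \<inter> H)) v"
      by (rule FJ.real_cond_exp_pos) auto
    show "AE v in Q. real_cond_exp Q (F J) (indicator (K \<inter> H)) v \<le> real_cond_exp Q (F J) (indicator K) v"
      by (rule FJ.real_cond_exp_mono) (auto simp: indicator_def)
  qed
  have "AE v in Q. \<forall>n\<in>{1..k}. real_cond_exp Q (F all_past) (indicator (D n \<inter> H)) v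
      = real_cond_exp Q (F (recent_past k)) (indicator (D n \<inter> H)) v"
    using part by (intro AE_finite_allI) auto
  then have "AE v in Q. \<bar>real_cond_exp Q (F (recent_past k)) (indicator H) v - real_cond_exp Q (F all_past) (indicator H) v\<bar> \<le> Q.prob K"
    using cond[of all_past] cond[of "recent_past k"] cK[of all_past, simplified] cK[of "recent_past k", OF recent(2)[OF order_refl]]
  proof eventually_elim
    case (elim v)
    then show ?case by (simp add: abs_le_iff)
  qed
  then show ?thesis by (simp add: cond_law_def cond_prob_given_def F_def H_def K_def)
qed

section \<open>Bounds on the variation and their transfer between processes of equal law\<close>

lemma borel_measurable_cond_law:
  "(\<lambda>w. cond_law M A X J w E) \<in> borel_measurable M"
  unfolding cond_law_def cond_prob_given_def by (rule borel_measurable_cond_exp2)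

text \<open>Stated as an equivalence because bounds are moved both ways: from a process to its path
  law, and from the path law to any other process that has it.\<close>

lemma AE_cond_law_process_law:
  fixes X :: "int \<Rightarrow> 'w \<Rightarrow> 'a"
  assumes M: "prob_space M" and X: "\<And>i. X i \<in> measurable M (count_space A)"
  shows "(AE w in M. \<bar>cond_law M A X J w E - cond_law M A X J' w E\<bar> \<le> c) \<longleftrightarrow>
    (AE \<omega> in process_law M (count_space A) X.
      \<bar>cond_law (process_law M (count_space A) X) A (\<lambda>i \<omega>. \<omega> i) J \<omega> E
        - cond_law (process_law M (count_space A) X) A (\<lambda>i \<omega>. \<omega> i) J' \<omega> E\<bar> \<le> c)"
    (is "?L \<longleftrightarrow> (AE \<omega> in ?P. ?R \<omega>)")
proof -
  let ?S = "\<Pi>\<^sub>M i\<in>(UNIV::int set). count_space A"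
  have P: "sets ?P = sets ?S" "space ?P = space ?S" by (simp_all add: process_law_def)
  have [measurable]: "(\<lambda>\<omega>. cond_law ?P A (\<lambda>i \<omega>. \<omega> i) J \<omega> E) \<in> borel_measurable ?P" for J
    by (rule borel_measurable_cond_law)
  have "{\<omega>\<in>space ?P. ?R \<omega>} \<in> sets ?P" by measurable
  then have "{\<omega>\<in>space ?S. ?R \<omega>} \<in> sets ?S" by (simp only: P)
  then have "(AE \<omega> in ?P. ?R \<omega>) \<longleftrightarrow> (AE w in M. ?R (\<lambda>i. X i w))"
    using measurable_path[OF X] unfolding process_law_def by (subst AE_distr_iff) auto
  also have "\<dots> \<longleftrightarrow> ?L"
  proof (rule eventually_subst)
    show "AE w in M. ?R (\<lambda>i. X i w) = (\<bar>cond_law M A X J w E - cond_law M A X J' w E\<bar> \<le> c)"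
      using cond_law_process_law[where X=X, OF M X, of J E] cond_law_process_law[where X=X, OF M X, of J' E]
      by eventually_elim simp
  qed
  finally show ?thesis ..
qed

lemma variation_leI:
  assumes "\<And>a. a \<in> A \<Longrightarrow> AE w in M. \<bar>cond_law M A X (recent_past k) w {a} - cond_law M A X all_past w {a}\<bar> \<le> c"
  shows "variation M A X k \<le> ennreal c"
  unfolding variation_def
proof (intro SUP_least esssup_I)
  show "(\<lambda>w. ennreal \<bar>cond_law M A X (recent_past k) w {a} - cond_law M A X all_past w {a}\<bar>) \<in> borel_measurable M" for a
    using borel_measurable_cond_law by measurable
  show "AE w in M. ennreal \<bar>cond_law M A X (recent_past k) w {a} - cond_law M A X all_past w {a}\<bar> \<le> ennreal c"
    if "a \<in> A" for a using assms[OF that] by (auto elim!: eventually_mono intro: ennreal_leI)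
qed

text \<open>The tail bound passes from \<open>Y\<close> to \<open>X\<close> because their path laws
  agree, and the tail probabilities of an integer variable sum to its expectation.\<close>

lemma summable_variation_if_finite_expected_lookback:
  assumes rep: "complete_rsm_representation M A X Q Y L" and fin: "finite_expected_lookback Q L"
  shows "(\<Sum>n. variation M A X n) < \<infinity>"
proof -
  have M: "prob_space M" and X: "\<And>i. X i \<in> measurable M (count_space A)"
    using rep by (auto simp: complete_rsm_representation_def stationary_process_def)
  note st = rep[unfolded complete_rsm_representation_def, THEN conjunct2, THEN conjunct1]
  interpret Q: prob_space Q by (rule stationary_process_pairD[OF st])
  have Y: "\<And>i. Y i \<in> measurable Q (count_space A)"
    and L: "\<And>i. L i \<in> measurable Q (count_space {1..})"
    using stationary_process_pairD[OF st] by auto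
  have L': "L i \<in> measurable Q (count_space UNIV)" for i
    using measurable_compose[OF L, of "\<lambda>x. x" "count_space UNIV"] by simp
  have law: "process_law Q (count_space A) Y = process_law M (count_space A) X"
    using rep by (simp add: complete_rsm_representation_def)
  have "variation M A X k \<le> ennreal (Q.prob {v \<in> space Q. k < L 0 v})" for k
  proof (rule variation_leI)
    fix a assume "a \<in> A"
    then show "AE w in M. \<bar>cond_law M A X (recent_past k) w {a} - cond_law M A X all_past w {a}\<bar>
        \<le> Q.prob {v \<in> space Q. k < L 0 v}"
      unfolding AE_cond_law_process_law[OF M X] law[symmetric]
      unfolding AE_cond_law_process_law[OF Q.prob_space_axioms Y, symmetric]
      by (intro cond_law_diff_le_lookback_tail[OF rep]) simp
  qed
  then have "(\<Sum>k. variation M A X k) \<le> (\<Sum>k. emeasure Q {v \<in> space Q. k < L 0 v})"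
    by (intro suminf_le) (auto simp: Q.emeasure_eq_measure)
  also have "\<dots> = (\<integral>\<^sup>+ v. of_nat (L 0 v) \<partial>Q)"
    using nn_integral_nat_function[OF L'[of 0]] by simp
  also have "\<dots> < \<infinity>" using fin by (simp add: finite_expected_lookback_def)
  finally show ?thesis .
qed

section \<open>Conditional probabilities of single letters\<close>

lemma cond_law_bounds:
  fixes X :: "int \<Rightarrow> 'w \<Rightarrow> 'a"
  assumes M: "prob_space M" and X: "\<And>i. X i \<in> measurable M (count_space A)" and "a \<in> A"
  shows "AE w in M. 0 \<le> cond_law M A X J w {a} \<and> cond_law M A X J w {a} \<le> 1"
proof -
  interpret prob_space M by fact
  interpret sigma_finite_subalgebra M "vimage_algebra (space M) (block X J) (block_space A J)"
    by (intro sigma_finite_subalgebra_vimage measurable_block X)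
  have "{v \<in> space M. X 0 v \<in> {a}} = X 0 -` {a} \<inter> space M" by auto
  then have H: "{v \<in> space M. X 0 v \<in> {a}} \<in> sets M"
    using X[of 0] \<open>a \<in> A\<close> by (auto intro: measurable_sets)
  show ?thesis unfolding cond_law_def cond_prob_given_def
    by (intro AE_conjI real_cond_exp_pos real_cond_exp_le_c)
      (use H in \<open>auto intro!: integrable_real_indicator simp: emeasure_eq_measure simp del: singleton_iff\<close>)
qed

lemma sum_cond_law:
  fixes X :: "int \<Rightarrow> 'w \<Rightarrow> 'a"
  assumes M: "prob_space M" and X: "\<And>i. X i \<in> measurable M (count_space A)" and A: "finite A"
  shows "AE w in M. (\<Sum>a\<in>A. cond_law M A X J w {a}) = 1"
proof -
  interpret prob_space M by fact
  interpret sigma_finite_subalgebra M "vimage_algebra (space M) (block X J) (block_space A J)"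
    by (intro sigma_finite_subalgebra_vimage measurable_block X)
  let ?F = "vimage_algebra (space M) (block X J) (block_space A J)"
  let ?H = "\<lambda>a. {v \<in> space M. X 0 v \<in> {a}}"
  have H: "?H a \<in> sets M" for a
  proof -
    have "?H a = X 0 -` ({a} \<inter> A) \<inter> space M" using measurable_space[OF X] by auto
    then show ?thesis using measurable_sets[OF X[of 0], of "{a} \<inter> A"] by simp
  qed
  then have int: "integrable M (indicat_real (?H a))" for a
    by (auto intro!: integrable_real_indicator simp: emeasure_eq_measure)
  have "AE w in M. real_cond_exp M ?F (\<lambda>w. \<Sum>a\<in>A. indicator (?H a) w) w = (\<Sum>a\<in>A. real_cond_exp M ?F (indicator (?H a)) w)"
    by (rule real_cond_exp_sum[OF int])
  moreover have "AE w in M. real_cond_exp M ?F (\<lambda>w. \<Sum>a\<in>A. indicator (?H a) w) w = real_cond_exp M ?F (\<lambda>w. 1) w"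
  proof (rule real_cond_exp_cong[OF AE_I2])
    fix w assume w: "w \<in> space M"
    have "(\<Sum>a\<in>A. indicat_real (?H a) w) = (\<Sum>a\<in>A. if a = X 0 w then 1 else 0)"
      using w by (intro sum.cong) (auto simp: indicator_def)
    then show "(\<Sum>a\<in>A. indicat_real (?H a) w) = 1"
      using A measurable_space[OF X w, of 0] by simp
  qed (use int in auto)
  moreover have "AE w in M. real_cond_exp M ?F (\<lambda>w. 1) w = 1"
    by (rule real_cond_exp_F_meas) auto
  ultimately show ?thesis unfolding cond_law_def cond_prob_given_def by eventually_elim simp
qed

text \<open>A single letter is one of the events over which the total variation distance takes its
  supremum, and that supremum is bounded because \<open>A\<close> has finitely many subsets.\<close>

lemma uniform_martingale_variation_tendsto_0:
  assumes A: "finite A" and um: "uniform_martingale M A X"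
  shows "variation M A X \<longlonglongrightarrow> 0"
proof (rule order_tendstoI)
  fix y :: ennreal assume "0 < y"
  then obtain e where e: "0 < e" "ennreal e < y"
    by (metis dense ennreal_cases ennreal_less_zero_iff less_top_ennreal top.not_eq_extremum order_less_trans)
  from um e obtain n0 where n0: "\<And>n. n \<ge> n0 \<Longrightarrow> AE w in M.
      tv_dist A (cond_law M A X all_past w) (cond_law M A X (recent_past n) w) < e"
    unfolding uniform_martingale_def by blast
  have "variation M A X n \<le> ennreal e" if "n \<ge> n0" for n
  proof (rule variation_leI)
    fix a assume a: "a \<in> A"
    show "AE w in M. \<bar>cond_law M A X (recent_past n) w {a} - cond_law M A X all_past w {a}\<bar> \<le> e"
      using n0[OF that]
    proof eventually_elim
      case (elim w)
      have "\<bar>cond_law M A X all_past w {a} - cond_law M A X (recent_past n) w {a}\<bar>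
          \<le> tv_dist A (cond_law M A X all_past w) (cond_law M A X (recent_past n) w)"
        unfolding tv_dist_def using A a by (intro cSUP_upper bdd_above_finite) auto
      with elim show ?case by linarith
    qed
  qed
  with e(2) show "\<forall>\<^sub>F n in sequentially. variation M A X n < y"
    by (intro eventually_sequentiallyI[of n0]) (meson order_le_less_trans)
qed simp

section \<open>Greedy splitting of the conditional law\<close>

text \<open>The unassigned mass \<open>R n\<close> of the greedy splitting, with \<open>c\<close>
  the reciprocal of the number of letters. The minimum covers the stages at which the guaranteed
  amount \<open>c * R n - v n\<close> is not positive and nothing is assigned.\<close>

primrec lookback_tail :: "real \<Rightarrow> (nat \<Rightarrow> real) \<Rightarrow> nat \<Rightarrow> real" where
  "lookback_tail c v 0 = 1"
| "lookback_tail c v (Suc n) = min (lookback_tail c v n) ((1 - c) * lookback_tail c v n + v n)"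

context
  fixes c :: real and v :: "nat \<Rightarrow> real"
  assumes c: "0 < c" "c \<le> 1" and v: "\<And>n. 0 \<le> v n"
begin

lemma lookback_tail_nonneg: "0 \<le> lookback_tail c v n"
  by (induction n) (use c v in auto)

lemma lookback_tail_decseq: "decseq (lookback_tail c v)"
  by (rule decseq_SucI) simp

lemma lookback_tail_Suc_le: "lookback_tail c v (Suc n) \<le> (1 - c) * lookback_tail c v n + v n"
  by simp

text \<open>The limit \<open>l\<close> of this decreasing sequence satisfies
  \<open>l <= (1 - c) * l\<close>, which leaves only 0.\<close>

lemma lookback_tail_tendsto_0:
  assumes "v \<longlonglongrightarrow> 0"
  shows "lookback_tail c v \<longlonglongrightarrow> 0"
proof -
  obtain l where l: "lookback_tail c v \<longlonglongrightarrow> l" "\<And>n. l \<le> lookback_tail c v n"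
    using decseq_convergent[OF lookback_tail_decseq, of 0] lookback_tail_nonneg by blast
  have "l \<le> (1 - c) * l + 0"
    by (rule LIMSEQ_le[OF LIMSEQ_Suc[OF l(1)] tendsto_add[OF tendsto_mult_left[OF l(1)] assms]])
      (use lookback_tail_Suc_le in blast)
  then have "c * l \<le> 0" by (simp add: algebra_simps)
  moreover have "0 \<le> l" by (rule LIMSEQ_le_const[OF l(1)]) (use lookback_tail_nonneg in blast)
  ultimately have "l = 0" using c by (simp add: mult_le_0_iff)
  with l show ?thesis by simp
qed

text \<open>Summing the recursion bounds each partial sum \<open>S\<close> by
  \<open>1 + (1 - c) * S + suminf v\<close>; solving for \<open>S\<close> gives a bound independent
  of the number of terms.\<close>

lemma summable_lookback_tail:
  assumes "summable v"
  shows "summable (lookback_tail c v)"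
proof (rule bounded_imp_summable)
  fix n
  let ?T = "lookback_tail c v"
  have "(\<Sum>k\<le>n. ?T (Suc k)) \<le> (\<Sum>k\<le>n. (1 - c) * ?T k + v k)"
    by (intro sum_mono lookback_tail_Suc_le)
  also have "\<dots> = (1 - c) * (\<Sum>k\<le>n. ?T k) + (\<Sum>k\<le>n. v k)"
    by (simp add: sum.distrib sum_distrib_left)
  also have "(\<Sum>k\<le>n. v k) \<le> suminf v"
    using assms v by (intro sum_le_suminf) auto
  finally have "(\<Sum>k\<le>n. ?T (Suc k)) \<le> (1 - c) * (\<Sum>k\<le>n. ?T k) + suminf v" by simp
  moreover have "(\<Sum>k\<le>n. ?T k) + ?T (Suc n) = 1 + (\<Sum>k\<le>n. ?T (Suc k))"
    using sum.atMost_Suc_shift[of ?T n] by (simp del: lookback_tail.simps(2))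
  moreover have "0 \<le> ?T (Suc n)" by (rule lookback_tail_nonneg)
  ultimately have "c * (\<Sum>k\<le>n. ?T k) \<le> 1 + suminf v" unfolding left_diff_distrib by linarith
  then show "(\<Sum>k\<le>n. ?T k) \<le> (1 + suminf v) / c"
    using c by (simp add: field_simps)
qed (rule lookback_tail_nonneg)

end

text \<open>Ties are broken by the first maximiser in a fixed enumeration of \<open>A\<close>, which
  makes the choice measurable in \<open>h\<close>.\<close>

definition pick_max :: "'a set \<Rightarrow> ('a \<Rightarrow> real) \<Rightarrow> 'a" where
  "pick_max A h = from_nat_into A (LEAST i. \<forall>b\<in>A. h b \<le> h (from_nat_into A i))"

lemma pick_max_in: "A \<noteq> {} \<Longrightarrow> pick_max A h \<in> A"
  unfolding pick_max_def by (rule from_nat_into)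

lemma pick_max_ge:
  assumes "finite A" "b \<in> A"
  shows "h b \<le> h (pick_max A h)"
proof -
  let ?m = "Max (h ` A)"
  have "?m \<in> h ` A" using assms by (intro Max_in) auto
  then obtain c where c: "c \<in> A" "h c = ?m" by auto
  have "\<forall>b\<in>A. h b \<le> h (from_nat_into A (to_nat_on A c))"
    using assms c by (simp add: countable_finite)
  then have "\<forall>b\<in>A. h b \<le> h (pick_max A h)"
    unfolding pick_max_def by (rule LeastI)
  then show ?thesis using assms by blast
qed

lemma measurable_pick_max:
  assumes "finite A" "A \<noteq> {}" and h: "\<And>a. a \<in> A \<Longrightarrow> (\<lambda>w. h w a) \<in> borel_measurable F"
  shows "(\<lambda>w. pick_max A (h w)) \<in> measurable F (count_space A)"
proof -
  have [measurable]: "(\<lambda>w. h w (from_nat_into A i)) \<in> borel_measurable F" for i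
    using assms by (intro h from_nat_into)
  have "Measurable.pred F (\<lambda>w. \<forall>b\<in>A. h w b \<le> h w (from_nat_into A i))" for i
  proof (intro pred_intros_finite assms(1))
    fix b assume "b \<in> A"
    note [measurable] = h[OF this]
    show "Measurable.pred F (\<lambda>w. h w b \<le> h w (from_nat_into A i))" by measurable
  qed
  then have "(\<lambda>w. LEAST i. \<forall>b\<in>A. h w b \<le> h w (from_nat_into A i)) \<in> measurable F (count_space UNIV)"
    by (rule measurable_Least)
  from measurable_compose[OF this, of "from_nat_into A" "count_space A"] show ?thesis
    unfolding pick_max_def using from_nat_into[OF assms(2)] by simp
qed

text \<open>
  \<open>\<pi> n w a\<close> estimates the probability of \<open>a\<close> from the last \<open>n\<close> letters, and \<open>greedy_mass\<close> is the mass
  that a letter has received before stage \<open>n\<close>.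
\<close>

primrec greedy_mass :: "'a set \<Rightarrow> (nat \<Rightarrow> real) \<Rightarrow> (nat \<Rightarrow> 'w \<Rightarrow> 'a \<Rightarrow> real) \<Rightarrow> nat \<Rightarrow> 'w \<Rightarrow> 'a \<Rightarrow> real" where
  "greedy_mass A q \<pi> 0 w a = 0"
| "greedy_mass A q \<pi> (Suc n) w a = greedy_mass A q \<pi> n w a
     + q n * of_bool (pick_max A (\<lambda>b. \<pi> n w b - greedy_mass A q \<pi> n w b) = a)"

definition greedy_letter :: "'a set \<Rightarrow> (nat \<Rightarrow> real) \<Rightarrow> (nat \<Rightarrow> 'w \<Rightarrow> 'a \<Rightarrow> real) \<Rightarrow> nat \<Rightarrow> 'w \<Rightarrow> 'a" where
  "greedy_letter A q \<pi> n w = pick_max A (\<lambda>b. \<pi> n w b - greedy_mass A q \<pi> n w b)"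

lemma greedy_mass_Suc:
  "greedy_mass A q \<pi> (Suc n) w a = greedy_mass A q \<pi> n w a + q n * of_bool (greedy_letter A q \<pi> n w = a)"
  by (simp add: greedy_letter_def)

lemma greedy_mass_eq_sum:
  "greedy_mass A q \<pi> n w a = (\<Sum>m<n. q m * of_bool (greedy_letter A q \<pi> m w = a))"
  by (induction n) (simp_all add: greedy_mass_Suc del: greedy_mass.simps(2))

lemma sum_greedy_mass:
  assumes "finite A" "A \<noteq> {}"
  shows "(\<Sum>a\<in>A. greedy_mass A q \<pi> n w a) = (\<Sum>m<n. q m)"
proof (induction n)
  case (Suc n)
  have "(\<Sum>a\<in>A. q n * of_bool (greedy_letter A q \<pi> n w = a)) = (\<Sum>a\<in>A. if a = greedy_letter A q \<pi> n w then q n else 0)"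
    by (intro sum.cong) auto
  also have "\<dots> = q n"
    using assms by (simp add: greedy_letter_def pick_max_in)
  finally show ?case using Suc by (simp add: greedy_mass_Suc sum.distrib del: greedy_mass.simps(2))
qed simp

text \<open>The letter of stage \<open>n\<close> is chosen from the estimates and masses of that
  stage, and these masses depend on earlier letters only. The induction therefore alternates between
  masses and letters along the increasing algebras.\<close>

lemma measurable_greedy:
  assumes A: "finite A" "A \<noteq> {}"
    and F: "\<And>n. subalgebra (F (Suc n)) (F n)"
    and \<pi>: "\<And>n a. a \<in> A \<Longrightarrow> (\<lambda>w. \<pi> n w a) \<in> borel_measurable (F n)"
  shows "greedy_letter A q \<pi> n \<in> measurable (F n) (count_space A)"
proof -
  have letter: "greedy_letter A q \<pi> n \<in> measurable (F n) (count_space A)"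
    if "\<And>a. a \<in> A \<Longrightarrow> (\<lambda>w. greedy_mass A q \<pi> n w a) \<in> borel_measurable (F n)" for n
    unfolding greedy_letter_def[abs_def]
    by (intro measurable_pick_max A borel_measurable_diff \<pi> that)
  have "(\<lambda>w. greedy_mass A q \<pi> n w a) \<in> borel_measurable (F n)" if "a \<in> A" for a n
    using that
  proof (induction n arbitrary: a)
    case (Suc n)
    note [measurable] = measurable_from_subalg[OF F letter[OF Suc.IH]]
      measurable_from_subalg[OF F Suc.IH[OF Suc.prems]]
    have "{w\<in>space (F (Suc n)). greedy_letter A q \<pi> n w = a} = greedy_letter A q \<pi> n -` {a} \<inter> space (F (Suc n))"
      by auto
    also have "\<dots> \<in> sets (F (Suc n))"
      using Suc.prems by (intro measurable_sets[of _ _ "count_space A"]) auto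
    finally have "Measurable.pred (F (Suc n)) (\<lambda>w. greedy_letter A q \<pi> n w = a)"
      by (simp add: pred_def)
    then show ?case unfolding greedy_mass_Suc of_bool_def by measurable
  qed simp
  then show ?thesis by (rule letter)
qed

text \<open>The invariant is that no letter ever receives more than its probability. In the limit
  the received masses also have total 1, so none of these inequalities can be strict.\<close>

lemma greedy_mass_limit:
  fixes \<pi> :: "nat \<Rightarrow> 'w \<Rightarrow> 'a \<Rightarrow> real" and v :: "nat \<Rightarrow> real" and A :: "'a set"
  defines "c \<equiv> 1 / card A"
  defines "q \<equiv> \<lambda>n. lookback_tail c v n - lookback_tail c v (Suc n)"
  assumes A: "finite A" "A \<noteq> {}" and v: "\<And>n. 0 \<le> v n" "v \<longlonglongrightarrow> 0"
    and p: "\<And>a. a \<in> A \<Longrightarrow> 0 \<le> p a" "(\<Sum>a\<in>A. p a) = 1"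
    and \<pi>: "\<And>n. (\<Sum>a\<in>A. \<pi> n w a) = 1" "\<And>n a. a \<in> A \<Longrightarrow> \<bar>\<pi> n w a - p a\<bar> \<le> v n"
    and a: "a \<in> A"
  shows "(\<lambda>n. q n * of_bool (greedy_letter A q \<pi> n w = a)) sums p a"
proof -
  have c: "0 < c" "c \<le> 1" using A by (auto simp: c_def field_simps Suc_le_eq card_gt_0_iff)
  have q0: "0 \<le> q n" for n by (simp add: q_def)
  have sq: "(\<Sum>m<n. q m) = 1 - lookback_tail c v n" for n
    unfolding q_def by (subst sum_lessThan_telescope') simp
  let ?s = "\<lambda>n. greedy_mass A q \<pi> n w"
  have le: "?s n b \<le> p b" if "b \<in> A" for n b
    using that
  proof (induction n arbitrary: b)
    case (Suc n)
    let ?f = "greedy_letter A q \<pi> n w"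
    have f: "?f \<in> A" by (simp add: greedy_letter_def A pick_max_in)
    show ?case
    proof (cases "b = ?f \<and> q n \<noteq> 0")
      case True
      \<comment> \<open>The chosen letter has the largest estimated remainder, hence at least the
        average one, which is \<open>c\<close> times the unassigned mass.\<close>
      have "(\<Sum>b\<in>A. \<pi> n w b - ?s n b) \<le> (\<Sum>b\<in>A. \<pi> n w ?f - ?s n ?f)"
        unfolding greedy_letter_def by (intro sum_mono pick_max_ge A)
      also have "(\<Sum>b\<in>A. \<pi> n w b - ?s n b) = lookback_tail c v n"
        by (simp add: sum_subtractf sum_greedy_mass A \<pi> sq)
      finally have "lookback_tail c v n \<le> card A * (\<pi> n w ?f - ?s n ?f)" by simp
      then have "c * lookback_tail c v n \<le> \<pi> n w ?f - ?s n ?f"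
        using A by (simp add: c_def divide_le_eq mult.commute card_gt_0_iff)
      \<comment> \<open>Since \<open>q n\<close> is not 0, the minimum in
        \<open>lookback_tail\<close> is attained by its second argument. Subtracting
        \<open>v n\<close> then compensates the error of the estimate.\<close>
      moreover have "q n = c * lookback_tail c v n - v n"
        using True by (auto simp: q_def min_def algebra_simps split: if_splits)
      moreover have "\<pi> n w ?f \<le> p ?f + v n" using \<pi>(2)[OF f, of n] by linarith
      ultimately show ?thesis using True by (simp add: greedy_mass_Suc del: greedy_mass.simps(2))
    next
      case False
      then show ?thesis using Suc by (auto simp: greedy_mass_Suc simp del: greedy_mass.simps(2))
    qed
  qed (simp add: p)
  have part: "(\<Sum>m<n. q m * of_bool (greedy_letter A q \<pi> m w = b)) = ?s n b" for n b
    by (simp add: greedy_mass_eq_sum)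
  have "summable (\<lambda>n. q n * of_bool (greedy_letter A q \<pi> n w = b))" if "b \<in> A" for b
    by (rule summableI_nonneg_bounded[where x="p b"]) (use q0 le[OF that] in \<open>auto simp: part simp del: of_bool_eq_iff\<close>)
  then obtain \<sigma> where "\<forall>b\<in>A. (\<lambda>n. q n * of_bool (greedy_letter A q \<pi> n w = b)) sums \<sigma> b"
    by (meson summable_sums)
  then have \<sigma>: "(\<lambda>n. ?s n b) \<longlonglongrightarrow> \<sigma> b" if "b \<in> A" for b
    using that by (simp add: sums_def part)
  have "\<sigma> b \<le> p b" if "b \<in> A" for b
    by (rule LIMSEQ_le_const2[OF \<sigma>[OF that]]) (use le[OF that] in auto)
  moreover have "(\<lambda>n. \<Sum>b\<in>A. ?s n b) \<longlonglongrightarrow> (\<Sum>b\<in>A. \<sigma> b)" by (intro tendsto_sum \<sigma>)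
  then have "(\<lambda>n. 1 - lookback_tail c v n) \<longlonglongrightarrow> (\<Sum>b\<in>A. \<sigma> b)" by (simp add: sum_greedy_mass A sq)
  moreover have "(\<lambda>n. 1 - lookback_tail c v n) \<longlonglongrightarrow> 1 - 0"
    by (intro tendsto_intros lookback_tail_tendsto_0 c v)
  \<comment> \<open>Termwise inequality together with equal finite sums forces termwise
    equality.\<close>
  ultimately have "\<sigma> a = p a"
    using LIMSEQ_unique p(2) A(1) a by (intro sum_mono_inv[of \<sigma> A p]) force+
  with \<sigma>[OF a] show ?thesis by (simp add: sums_def part)
qed

section \<open>The coupling\<close>

text \<open>The inverse of the cumulative distribution function of the weights \<open>k\<close>. The
  default 1 keeps look-back distances positive even on the null set of paths whose weights do not
  sum to 1.\<close>

definition quantile :: "(nat \<Rightarrow> real) \<Rightarrow> real \<Rightarrow> nat" where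
  "quantile k t = (if \<exists>n. t < (\<Sum>m\<le>n. k m) then LEAST n. t < (\<Sum>m\<le>n. k m) else 1)"

lemma measurable_quantile:
  assumes [measurable]: "\<And>n. (\<lambda>x. k x n) \<in> borel_measurable K" "t \<in> borel_measurable K"
  shows "(\<lambda>x. quantile (k x) (t x)) \<in> measurable K (count_space UNIV)"
  unfolding quantile_def by measurable

lemma quantile_ge_1: "k 0 = 0 \<Longrightarrow> 0 \<le> t \<Longrightarrow> 1 \<le> quantile k t"
proof -
  assume k: "k 0 = 0" and t: "0 \<le> t"
  have "(LEAST n. t < (\<Sum>m\<le>n. k m)) \<noteq> 0" if "\<exists>n. t < (\<Sum>m\<le>n. k m)"
  proof
    assume "(LEAST n. t < (\<Sum>m\<le>n. k m)) = 0"
    with LeastI_ex[OF that] k t show False by simp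
  qed
  then show ?thesis by (auto simp: quantile_def Suc_le_eq)
qed

text \<open>The half-open interval has length \<open>k n\<close>, which gives the distribution of
  the sampled value. It is empty if \<open>k n\<close> is 0, so a value of weight 0 is never
  drawn.\<close>

lemma quantile_eq_iff:
  assumes k: "\<And>n. 0 \<le> k n" "k sums 1" and t: "0 \<le> t" "t < 1"
  shows "quantile k t = n \<longleftrightarrow> (\<Sum>m<n. k m) \<le> t \<and> t < (\<Sum>m<n. k m) + k n"
proof -
  let ?F = "\<lambda>n. \<Sum>m\<le>n. k m"
  have "?F \<longlonglongrightarrow> 1" using k(2) by (simp add: sums_def_le)
  then have "\<forall>\<^sub>F n in sequentially. t < ?F n" by (rule order_tendstoD) fact
  then have ex: "\<exists>n. t < ?F n" by (auto dest: eventually_happens)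
  then have q: "quantile k t = (LEAST n. t < ?F n)" by (simp add: quantile_def)
  have F: "?F n = (\<Sum>m<n. k m) + k n" by (simp flip: lessThan_Suc_atMost)
  show ?thesis
  proof
    assume n: "quantile k t = n"
    have "(\<Sum>m<n. k m) \<le> t"
    proof (cases n)
      case (Suc n')
      then have "\<not> t < ?F n'" using n q not_less_Least[of n' "\<lambda>n. t < ?F n"] by simp
      then show ?thesis using Suc by (simp add: lessThan_Suc_atMost)
    qed (simp add: t)
    then show "(\<Sum>m<n. k m) \<le> t \<and> t < (\<Sum>m<n. k m) + k n"
      using LeastI_ex[OF ex] F n q by simp
  next
    assume n: "(\<Sum>m<n. k m) \<le> t \<and> t < (\<Sum>m<n. k m) + k n"
    show "quantile k t = n" unfolding q
    proof (rule Least_equality)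
      show "t < ?F n" using n F by simp
      show "n \<le> m" if "t < ?F m" for m
      proof (rule ccontr)
        assume "\<not> n \<le> m"
        then have "?F m \<le> (\<Sum>m<n. k m)" using k(1) by (intro sum_mono2) auto
        with n that show False by simp
      qed
    qed
  qed
qed

text \<open>The endpoint 1 is excluded because no partial sum of weights with total 1 exceeds
  it.\<close>

abbreviation unit_interval :: "real measure" where
  "unit_interval \<equiv> restrict_space lborel {0..<1}"

lemma prob_space_unit_interval: "prob_space unit_interval"
  by (rule prob_spaceI) (simp add: space_restrict_space emeasure_restrict_space)

lemma emeasure_quantile:
  assumes k: "\<And>n. 0 \<le> k n" "k sums 1"
  shows "{t \<in> {0..<1}. quantile k t = n} \<in> sets unit_interval"
    and "emeasure unit_interval {t \<in> {0..<1}. quantile k t = n} = ennreal (k n)"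
proof -
  let ?a = "\<Sum>m<n. k m"
  have a: "0 \<le> ?a" "?a + k n \<le> 1"
    using k sum_le_suminf[of k "{..<Suc n}"] by (auto intro: sum_nonneg simp: sums_iff)
  have eq: "{t \<in> {0..<1}. quantile k t = n} = {?a..<?a + k n}"
  proof (rule set_eqI)
    fix t
    show "t \<in> {t \<in> {0..<1}. quantile k t = n} \<longleftrightarrow> t \<in> {?a..<?a + k n}"
    proof (cases "0 \<le> t \<and> t < 1")
      case True
      then show ?thesis using quantile_eq_iff[where k=k and t=t and n=n, OF k] by simp
    next
      case False
      then show ?thesis using a by auto
    qed
  qed
  have sub: "{?a..<?a + k n} \<subseteq> {0..<1}" using a by auto
  show "{t \<in> {0..<1}. quantile k t = n} \<in> sets unit_interval"
    unfolding eq using sub by (subst sets_restrict_space_iff) auto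
  show "emeasure unit_interval {t \<in> {0..<1}. quantile k t = n} = ennreal (k n)"
    unfolding eq using sub k(1)[of n] by (subst emeasure_restrict_space) auto
qed

text \<open>The coordinates of a product measure are independent, hence so are the restrictions to
  the disjoint index sets \<open>{i}\<close> and \<open>J\<close>.\<close>

lemma emeasure_PiM_coordinate_indep:
  assumes U: "prob_space U" and S: "S \<in> sets U" and W: "W \<in> sets (\<Pi>\<^sub>M i\<in>J. U)" and "i \<notin> J"
  defines "N \<equiv> \<Pi>\<^sub>M i\<in>UNIV. U"
  shows "emeasure N {u \<in> space N. u i \<in> S \<and> restrict u J \<in> W}
    = emeasure U S * emeasure N {u \<in> space N. restrict u J \<in> W}"
proof -
  interpret U: prob_space U by fact
  interpret N: product_prob_space "\<lambda>_. U" UNIV by unfold_locales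
  have N: "prob_space N" unfolding N_def by (intro prob_space_PiM U)
  interpret N': prob_space N by fact
  have ci: "distr N U (\<lambda>u. u j) = U" for j unfolding N_def by (rule N.PiM_component) simp
  have "N'.indep_vars (\<lambda>_. U) (\<lambda>j u. u j) UNIV"
  proof (rule N'.indep_vars_iff_distr_eq_PiM[THEN iffD2])
    show "(\<lambda>u. u j) \<in> measurable N U" for j unfolding N_def by simp
    show "distr N (\<Pi>\<^sub>M i\<in>UNIV. U) (\<lambda>x. \<lambda>i\<in>UNIV. x i) = (\<Pi>\<^sub>M i\<in>UNIV. distr N U (\<lambda>u. u i))"
      unfolding ci restrict_UNIV N_def[symmetric] by (rule distr_id)
  qed simp
  then have "N'.indep_var (PiM {i} (\<lambda>_. U)) (\<lambda>u. restrict (\<lambda>j. u j) {i}) (PiM J (\<lambda>_. U)) (\<lambda>u. restrict (\<lambda>j. u j) J)"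
    using \<open>i \<notin> J\<close> by (intro N'.indep_var_restrict) auto
  note * = N'.indep_varD[OF this, of "{x \<in> space (PiM {i} (\<lambda>_. U)). x i \<in> S}" W]
  have r: "restrict u K \<in> space (PiM K (\<lambda>_. U))" if "u \<in> space N" for u and K
    using that by (auto simp: N_def space_PiM)
  have "N'.prob {u \<in> space N. u i \<in> S \<and> restrict u J \<in> W} =
      N'.prob {u \<in> space N. u i \<in> S} * N'.prob {u \<in> space N. restrict u J \<in> W}"
  proof -
    have "(\<lambda>u. (restrict (\<lambda>j. u j) {i}, restrict (\<lambda>j. u j) J)) -` ({x \<in> space (PiM {i} (\<lambda>_. U)). x i \<in> S} \<times> W) \<inter> space N
      = {u \<in> space N. u i \<in> S \<and> restrict u J \<in> W}"
      "(\<lambda>u. restrict (\<lambda>j. u j) {i}) -` {x \<in> space (PiM {i} (\<lambda>_. U)). x i \<in> S} \<inter> space N = {u \<in> space N. u i \<in> S}"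
      "(\<lambda>u. restrict (\<lambda>j. u j) J) -` W \<inter> space N = {u \<in> space N. restrict u J \<in> W}"
      using r by auto
    moreover have "{x \<in> space (PiM {i} (\<lambda>_. U)). x i \<in> S} \<in> sets (PiM {i} (\<lambda>_. U))"
      using S by (intro sets_Collect_single') auto
    ultimately show ?thesis using * W by simp
  qed
  moreover have "emeasure N {u \<in> space N. u i \<in> S} = emeasure U S"
  proof -
    have "emeasure U S = emeasure (distr N U (\<lambda>u. u i)) S" by (simp add: ci)
    also have "\<dots> = emeasure N {u \<in> space N. u i \<in> S}"
      using S by (subst emeasure_distr) (auto simp: N_def intro!: arg_cong[where f="emeasure _"])
    finally show ?thesis ..
  qed
  ultimately show ?thesis
    by (simp add: N'.emeasure_eq_measure U.emeasure_eq_measure ennreal_mult)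
qed

lemma pred_eq_finite_count_space:
  assumes A: "finite A" and g: "g \<in> measurable K (count_space A)" and h: "h \<in> measurable K (count_space A)"
  shows "Measurable.pred K (\<lambda>x. g x = h x)"
proof -
  have "{x\<in>space K. g x = h x} = (\<Union>a\<in>A. (g -` {a} \<inter> space K) \<inter> (h -` {a} \<inter> space K))"
    using measurable_space[OF h] by auto
  also have "\<dots> \<in> sets K"
    using A g h by (intro sets.finite_UN sets.Int measurable_sets) auto
  finally show ?thesis by (simp add: pred_def)
qed

lemma (in prob_space) nn_integral_eq_integral_bounded:
  assumes "g \<in> borel_measurable M" "\<And>x. 0 \<le> g x" "\<And>x. g x \<le> (1::real)"
  shows "(\<integral>\<^sup>+x. ennreal (g x) \<partial>M) = ennreal (\<integral>x. g x \<partial>M)"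
  by (rule nn_integral_eq_integral[OF integrable_const_bound[of _ 1]]) (use assms in auto)

text \<open>Where \<open>L 0\<close> equals \<open>n\<close>, the event that \<open>Y 0\<close> lies
  in \<open>E\<close> agrees almost everywhere with an event known from the block, and the
  conditional probability of a known event is its indicator.\<close>

lemma cond_law_lookback_determined:
  fixes Y :: "int \<Rightarrow> 'v \<Rightarrow> 'a" and L :: "int \<Rightarrow> 'v \<Rightarrow> nat"
  assumes Q: "prob_space Q" and Y: "\<And>i. Y i \<in> measurable Q (count_space A)"
    and L: "L 0 \<in> measurable Q (count_space {1..})" and n: "1 \<le> n" and E: "E \<subseteq> A"
    and g: "g \<in> measurable (vimage_algebra (space Q) (block Y J) (block_space A J)) (count_space A)"
    and det: "AE v in Q. L 0 v = n \<longrightarrow> g v = Y 0 v"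
  shows "AE v in Q. L 0 v = n \<longrightarrow> cond_law_lookback Q A Y L J v E = indicator E (g v)"
proof -
  interpret prob_space Q by fact
  let ?N = "block_space A J \<Otimes>\<^sub>M count_space {1::nat..}"
  let ?V = "\<lambda>v. (block Y J v, L 0 v)"
  let ?F = "vimage_algebra (space Q) (block Y J) (block_space A J)"
  define G where "G = vimage_algebra (space Q) ?V ?N"
  have V: "?V \<in> measurable Q ?N" by (intro measurable_Pair measurable_block Y L)
  interpret sigma_finite_subalgebra Q G
    unfolding G_def by (rule sigma_finite_subalgebra_vimage[OF V])
  have VG: "?V \<in> measurable G ?N"
    using V unfolding G_def by (intro measurable_vimage_algebra1) (auto simp: measurable_def)
  have GF: "subalgebra G ?F"
    using measurable_compose[OF VG measurable_fst] by (auto simp: subalgebra_def measurable_iff_sets G_def)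
  have LG: "L 0 \<in> measurable G (count_space {1..})"
    using measurable_compose[OF VG measurable_snd] by simp
  have gG: "g \<in> measurable G (count_space A)" by (rule measurable_from_subalg[OF GF g])
  define D where "D = {v \<in> space Q. L 0 v = n}"
  define H where "H = {v \<in> space Q. Y 0 v \<in> E}"
  have spG: "space G = space Q" by (simp add: G_def)
  have "D = L 0 -` {n} \<inter> space G" by (auto simp: D_def spG)
  then have DG: "D \<in> sets G" using n by (auto intro!: measurable_sets[OF LG])
  then have DQ: "D \<in> sets Q" using subalg by (auto simp: subalgebra_def)
  have "H = Y 0 -` E \<inter> space Q" by (auto simp: H_def)
  then have HQ: "H \<in> sets Q" using E by (auto intro!: measurable_sets[OF Y])
  have iG: "(\<lambda>v. indicat_real E (g v)) \<in> borel_measurable G"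
    by (rule measurable_compose[OF gG]) simp
  let ?h = "\<lambda>v. indicat_real D v * indicator E (g v)"
  have hG: "?h \<in> borel_measurable G" using DG iG by simp
  have hi: "integrable Q ?h"
    using measurable_from_subalg[OF subalg hG] by (intro integrable_const_bound[of _ 1]) (auto simp: indicator_def)
  have ii: "integrable Q (\<lambda>v. indicat_real D v * indicator H v)"
    using DQ HQ by (intro integrable_const_bound[of _ 1]) (auto simp: indicator_def)
  \<comment> \<open>The indicator of \<open>D\<close> is known from the conditioning data, so it can
    be moved in and out of the conditional expectation. This localises the claim to the sample
    points with \<open>L 0 v = n\<close>.\<close>
  have "AE v in Q. real_cond_exp Q G (\<lambda>v. indicat_real D v * indicator H v) v = indicator D v * real_cond_exp Q G (indicator H) v"
    using DG HQ ii by (intro real_cond_exp_mult) auto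
  moreover have "AE v in Q. real_cond_exp Q G (\<lambda>v. indicat_real D v * indicator H v) v = real_cond_exp Q G ?h v"
  proof (rule real_cond_exp_cong)
    show "AE v in Q. indicat_real D v * indicator H v = ?h v"
      using det AE_space by eventually_elim (auto simp: indicator_def D_def H_def)
  qed (use hi ii in auto)
  moreover have "AE v in Q. real_cond_exp Q G ?h v = ?h v"
    by (rule real_cond_exp_F_meas[OF hi hG])
  ultimately have "AE v in Q. L 0 v = n \<longrightarrow> real_cond_exp Q G (indicator H) v = indicator E (g v)"
    using AE_space by eventually_elim (auto simp: D_def)
  then show ?thesis by (simp add: cond_law_lookback_def cond_prob_given_def G_def H_def)
qed

text \<open>The output of the greedy splitting over the path law \<open>P\<close>: \<open>q\<close>
  becomes the distribution of the look-back distance, and \<open>f n\<close> the letter that is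
  predicted when this distance is \<open>n\<close>. The condition \<open>q 0 = 0\<close> reflects
  that distances are positive.\<close>

locale step_law = prob_space P for P :: "(int \<Rightarrow> 'a) measure" +
  fixes A :: "'a set" and q :: "nat \<Rightarrow> real" and f :: "nat \<Rightarrow> (int \<Rightarrow> 'a) \<Rightarrow> 'a"
  assumes finite_A: "finite A"
    and sets_P: "sets P = sets (\<Pi>\<^sub>M i\<in>UNIV. count_space A)"
    and shift_P: "\<And>k. distr P P (\<lambda>\<omega> i. \<omega> (i + k)) = P"
    and q_nonneg: "\<And>n. 0 \<le> q n" and q_0: "q 0 = 0" and q_sums: "q sums 1"
    and f_meas: "\<And>n. f n \<in> measurable
      (vimage_algebra (space P) (block (\<lambda>i \<omega>. \<omega> i) (recent_past n)) (block_space A (recent_past n))) (count_space A)"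
    and f_mass: "AE \<omega> in P. \<forall>a\<in>A. (\<lambda>n. q n * of_bool (f n \<omega> = a)) sums cond_law P A (\<lambda>i \<omega>. \<omega> i) all_past \<omega> {a}"
begin

definition past :: "int set \<Rightarrow> (int \<Rightarrow> 'a) measure" where
  "past J = vimage_algebra (space P) (block (\<lambda>i \<omega>. \<omega> i) J) (block_space A J)"

text \<open>A version of the conditional probability of \<open>a\<close> given the past that is
  defined by an explicit series at every path.\<close>

definition mass :: "(int \<Rightarrow> 'a) \<Rightarrow> 'a \<Rightarrow> real" where
  "mass \<omega> a = (\<Sum>n. q n * of_bool (f n \<omega> = a))"

text \<open>The conditional law of the look-back distance given the letters up to the present one.\<close>

definition step_weight :: "(int \<Rightarrow> 'a) \<Rightarrow> nat \<Rightarrow> real" where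
  "step_weight \<omega> n = q n * of_bool (f n \<omega> = \<omega> 0) / mass \<omega> (\<omega> 0)"

lemma space_P: "space P = {\<omega>. \<forall>i. \<omega> i \<in> A}"
proof -
  have "space P = (\<Pi>\<^sub>E i\<in>UNIV. A)"
    using sets_eq_imp_space_eq[OF sets_P] by (simp add: space_PiM)
  then show ?thesis by (simp only: PiE_UNIV_domain Pi_def) simp
qed

lemma coord_measurable: "(\<lambda>\<omega>. \<omega> i) \<in> measurable P (count_space A)"
  unfolding measurable_cong_sets[OF sets_P refl] by simp

lemma measurable_into_P:
  "(\<And>i. (\<lambda>x. g x i) \<in> measurable K (count_space A)) \<Longrightarrow> g \<in> measurable K P"
  unfolding measurable_cong_sets[OF refl sets_P] by (rule measurable_path[where X="\<lambda>i x. g x i"])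

lemma measurable_into_past:
  assumes "g \<in> space K \<rightarrow> space P" "\<And>j. j \<in> J \<Longrightarrow> (\<lambda>x. g x j) \<in> measurable K (count_space A)"
  shows "g \<in> measurable K (past J)"
  unfolding past_def block_def
  by (rule measurable_vimage_algebra2) (use assms in \<open>auto intro!: measurable_restrict\<close>)

lemma past_subalgebra: "subalgebra P (past J)"
  using sigma_finite_subalgebra_vimage[OF measurable_block[of "\<lambda>i \<omega>. \<omega> i", OF coord_measurable], of J]
  by (simp add: past_def sigma_finite_subalgebra_def)

lemma past_mono: "J \<subseteq> J' \<Longrightarrow> subalgebra (past J') (past J)"
  unfolding past_def by (rule subalgebra_block) (auto intro: coord_measurable)

lemma f_past: "f n \<in> measurable (past all_past) (count_space A)"
  by (rule measurable_from_subalg[OF past_mono f_meas[folded past_def]]) auto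

lemma f_in_A: "\<omega> \<in> space P \<Longrightarrow> f n \<omega> \<in> A"
  using measurable_space[OF f_past] by (simp add: past_def)

lemma step_terms: "0 \<le> q n * of_bool (f n \<omega> = a)" "summable (\<lambda>n. q n * of_bool (f n \<omega> = a))"
proof -
  show *: "0 \<le> q n * of_bool (f n \<omega> = a)" for n by (simp add: q_nonneg)
  show "summable (\<lambda>n. q n * of_bool (f n \<omega> = a))"
    by (rule summable_comparison_test'[OF sums_summable[OF q_sums], of 0]) (use q_nonneg in auto)
qed

lemma step_term_le_mass: "q n * of_bool (f n \<omega> = a) \<le> mass \<omega> a"
proof -
  have "t n \<le> suminf t" if "summable t" "\<And>m. 0 \<le> t m" for t :: "nat \<Rightarrow> real"
    using sum_le_suminf[OF that(1), of "{n}"] that(2) by simp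
  from this[OF step_terms(2) step_terms(1)] show ?thesis by (simp only: mass_def)
qed

lemma mass_nonneg: "0 \<le> mass \<omega> a"
  unfolding mass_def by (rule suminf_nonneg[OF step_terms(2,1)])

lemma step_weight_nonneg: "0 \<le> step_weight \<omega> n"
  by (simp add: step_weight_def q_nonneg mass_nonneg)

lemma step_weight_0: "step_weight \<omega> 0 = 0"
  by (simp add: step_weight_def q_0)

lemma step_weight_le_1: "step_weight \<omega> n \<le> 1"
  using step_term_le_mass[of n \<omega> "\<omega> 0"] mass_nonneg[of \<omega> "\<omega> 0"]
  by (auto simp: step_weight_def divide_le_eq_1 less_le)

text \<open>Only coordinates up to 0 enter. This is what later makes look-back distances at negative
  times measurable with respect to the history.\<close>

lemma measurable_step_weight:
  assumes g: "g \<in> space K \<rightarrow> space P" "\<And>j. j \<le> 0 \<Longrightarrow> (\<lambda>x. g x j) \<in> measurable K (count_space A)"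
  shows "(\<lambda>x. step_weight (g x) n) \<in> borel_measurable K"
proof -
  have "(\<lambda>x. f m (g x)) \<in> measurable K (count_space A)" for m
    by (rule measurable_compose[OF measurable_into_past f_past]) (use g in auto)
  then have [measurable]: "Measurable.pred K (\<lambda>x. f m (g x) = g x 0)" for m
    by (intro pred_eq_finite_count_space[OF finite_A] g) auto
  show ?thesis unfolding step_weight_def mass_def of_bool_def by measurable
qed

lemma cond_law_eq: "cond_law P A (\<lambda>i \<omega>. \<omega> i) all_past \<omega> {a} = real_cond_exp P (past all_past) (indicator {\<omega>\<in>space P. \<omega> 0 = a}) \<omega>"
  by (simp add: cond_law_def cond_prob_given_def past_def)

lemma letter_event: "{\<omega>\<in>space P. \<omega> 0 = a} \<in> events"
proof -
  have "{\<omega>\<in>space P. \<omega> 0 = a} = (\<lambda>\<omega>. \<omega> 0) -` ({a} \<inter> A) \<inter> space P" by (auto simp: space_P)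
  then show ?thesis using measurable_sets[OF coord_measurable, of "{a} \<inter> A" 0] by simp
qed

lemma mass_eq_cond: "AE \<omega> in P. \<forall>a\<in>A. mass \<omega> a = real_cond_exp P (past all_past) (indicator {\<omega>\<in>space P. \<omega> 0 = a}) \<omega>"
  using f_mass unfolding cond_law_eq by eventually_elim (auto simp: mass_def sums_iff)

lemma mass_measurable: "(\<lambda>\<omega>. mass \<omega> a) \<in> borel_measurable (past all_past)"
  and f_pred: "Measurable.pred (past all_past) (\<lambda>\<omega>. f n \<omega> = a)"
proof -
  show [measurable]: "Measurable.pred (past all_past) (\<lambda>\<omega>. f n \<omega> = a)" for n
  proof -
    have "{\<omega> \<in> space (past all_past). f n \<omega> = a} = f n -` ({a} \<inter> A) \<inter> space (past all_past)"
      using measurable_space[OF f_past] by auto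
    then show ?thesis using measurable_sets[OF f_past, of "{a} \<inter> A" n] by (simp add: pred_def)
  qed
  show "(\<lambda>\<omega>. mass \<omega> a) \<in> borel_measurable (past all_past)"
    unfolding mass_def of_bool_def by measurable
qed

text \<open>The defining property of the conditional probability of \<open>a\<close>, tested against
  a bounded function of the past, with \<open>mass\<close> as the chosen version.\<close>

lemma integral_past_letter:
  assumes g: "g \<in> borel_measurable (past all_past)" "\<And>\<omega>. \<bar>g \<omega>\<bar> \<le> (1::real)" and a: "a \<in> A"
  shows "integrable P (\<lambda>\<omega>. g \<omega> * indicator {\<omega>\<in>space P. \<omega> 0 = a} \<omega>)" (is "integrable P ?l")
    and "integrable P (\<lambda>\<omega>. g \<omega> * mass \<omega> a)"
    and "(\<integral>\<omega>. g \<omega> * indicator {\<omega>\<in>space P. \<omega> 0 = a} \<omega> \<partial>P) = (\<integral>\<omega>. g \<omega> * mass \<omega> a \<partial>P)"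
proof -
  interpret S: sigma_finite_subalgebra P "past all_past"
    unfolding past_def by (intro sigma_finite_subalgebra_vimage measurable_block coord_measurable)
  let ?H = "{\<omega>\<in>space P. \<omega> 0 = a}"
  let ?p = "real_cond_exp P (past all_past) (indicator ?H)"
  have gP[measurable]: "g \<in> borel_measurable P" by (rule measurable_from_subalg[OF past_subalgebra g(1)])
  note [measurable] = letter_event[of a] measurable_from_subalg[OF past_subalgebra mass_measurable[of a]]
  show i: "integrable P ?l"
    using g(2) by (intro integrable_const_bound[of _ 1]) (auto simp: indicator_def)
  have ae: "AE \<omega> in P. g \<omega> * ?p \<omega> = g \<omega> * mass \<omega> a"
    using mass_eq_cond by eventually_elim (use a in auto)
  have "integrable P (\<lambda>\<omega>. g \<omega> * ?p \<omega>)" "(\<integral>\<omega>. g \<omega> * ?p \<omega> \<partial>P) = (\<integral>\<omega>. ?l \<omega> \<partial>P)"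
    by (rule S.real_cond_exp_intg[OF i g(1)]; simp)+
  moreover have "integrable P (\<lambda>\<omega>. g \<omega> * ?p \<omega>) \<longleftrightarrow> integrable P (\<lambda>\<omega>. g \<omega> * mass \<omega> a)"
    by (rule integrable_cong_AE[OF _ _ ae]) auto
  moreover have "(\<integral>\<omega>. g \<omega> * ?p \<omega> \<partial>P) = (\<integral>\<omega>. g \<omega> * mass \<omega> a \<partial>P)"
    by (rule integral_cong_AE[OF _ _ ae]) auto
  ultimately show "integrable P (\<lambda>\<omega>. g \<omega> * mass \<omega> a)" "(\<integral>\<omega>. ?l \<omega> \<partial>P) = (\<integral>\<omega>. g \<omega> * mass \<omega> a \<partial>P)"
    by auto
qed

text \<open>The numerators sum to the denominator, so it suffices that the denominator is almost
  surely nonzero: a letter almost never occurs after a past that gives it probability 0.\<close>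

lemma AE_step_weight_sums: "AE \<omega> in P. step_weight \<omega> sums 1"
proof -
  have "AE \<omega> in P. \<omega> 0 = a \<longrightarrow> mass \<omega> a \<noteq> 0" if a: "a \<in> A" for a
  proof -
    let ?H = "{\<omega>\<in>space P. \<omega> 0 = a}"
    \<comment> \<open>This test function selects the pasts that give \<open>a\<close> no mass; its
      product with \<open>mass\<close> vanishes identically.\<close>
    let ?g = "\<lambda>\<omega>. of_bool (mass \<omega> a = 0) :: real"
    note [measurable] = mass_measurable[of a]
    have g: "?g \<in> borel_measurable (past all_past)"
      unfolding of_bool_def by measurable
    have "(\<integral>\<omega>. ?g \<omega> * indicator ?H \<omega> \<partial>P) = (\<integral>\<omega>. ?g \<omega> * mass \<omega> a \<partial>P)"
      by (rule integral_past_letter(3)[OF g _ a]) simp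
    also have "\<dots> = (\<integral>\<omega>. 0 \<partial>P)" by (rule Bochner_Integration.integral_cong) auto
    finally have "AE \<omega> in P. ?g \<omega> * indicator ?H \<omega> = 0"
      by (subst integral_nonneg_eq_0_iff_AE[symmetric]) (auto intro!: integral_past_letter(1)[OF g _ a])
    then show ?thesis using AE_space by eventually_elim (auto simp: indicator_def)
  qed
  then have "AE \<omega> in P. \<forall>a\<in>A. \<omega> 0 = a \<longrightarrow> mass \<omega> a \<noteq> 0"
    using finite_A by (intro AE_finite_allI) auto
  then show ?thesis using AE_space
  proof eventually_elim
    case (elim \<omega>)
    then have "mass \<omega> (\<omega> 0) \<noteq> 0" by (auto simp: space_P)
    moreover have "(\<lambda>n. q n * of_bool (f n \<omega> = \<omega> 0)) sums mass \<omega> (\<omega> 0)"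
      unfolding mass_def by (rule summable_sums[OF step_terms(2)])
    ultimately show ?case
      using sums_divide[of _ "mass \<omega> (\<omega> 0)" "mass \<omega> (\<omega> 0)"] by (simp add: step_weight_def[abs_def])
  qed
qed

text \<open>Given the past, the present letter is \<open>a\<close> with probability \<open>mass \<omega> a\<close>, which cancels the denominator of \<open>step_weight\<close>.\<close>

lemma integral_step_weight:
  assumes b: "b \<in> borel_measurable (past all_past)" "\<And>\<omega>. 0 \<le> b \<omega>" "\<And>\<omega>. b \<omega> \<le> (1::real)"
  shows "(\<integral>\<omega>. step_weight \<omega> n * b \<omega> \<partial>P) = q n * (\<integral>\<omega>. b \<omega> \<partial>P)"
proof -
  \<comment> \<open>The integrand with the present letter replaced by a fixed \<open>a\<close>,
    which turns it into a function of the past.\<close>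
  define w where "w a \<omega> = b \<omega> * (q n * of_bool (f n \<omega> = a) / mass \<omega> a)" for a \<omega>
  let ?H = "\<lambda>a. {\<omega>\<in>space P. \<omega> 0 = a}"
  have wm: "w a \<in> borel_measurable (past all_past)" for a
  proof -
    note [measurable] = mass_measurable[of a] f_pred[of n a] b(1)
    show ?thesis unfolding w_def[abs_def] of_bool_def by measurable
  qed
  have w1: "\<bar>w a \<omega>\<bar> \<le> 1" for a \<omega>
  proof -
    have "q n * of_bool (f n \<omega> = a) / mass \<omega> a \<le> 1"
      using step_term_le_mass[of n \<omega> a] mass_nonneg[of \<omega> a] by (auto simp: divide_le_eq_1 less_le)
    moreover have "0 \<le> q n * of_bool (f n \<omega> = a) / mass \<omega> a" using q_nonneg mass_nonneg by simp
    ultimately have "0 \<le> w a \<omega>" "w a \<omega> \<le> 1"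
      unfolding w_def using b(2,3)[of \<omega>] by (auto intro!: mult_nonneg_nonneg mult_le_one simp del: times_divide_eq_right)
    then show ?thesis by simp
  qed
  have "(\<integral>\<omega>. step_weight \<omega> n * b \<omega> \<partial>P) = (\<integral>\<omega>. (\<Sum>a\<in>A. w a \<omega> * indicator (?H a) \<omega>) \<partial>P)"
  proof (rule Bochner_Integration.integral_cong[OF refl])
    fix \<omega> assume \<omega>: "\<omega> \<in> space P"
    have "(\<Sum>a\<in>A. w a \<omega> * indicator (?H a) \<omega>) = (\<Sum>a\<in>A. if a = \<omega> 0 then w a \<omega> else 0)"
      using \<omega> by (intro sum.cong) (auto simp: indicator_def)
    also have "\<dots> = w (\<omega> 0) \<omega>" using \<omega> finite_A by (simp add: space_P)
    finally show "step_weight \<omega> n * b \<omega> = (\<Sum>a\<in>A. w a \<omega> * indicator (?H a) \<omega>)"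
      by (simp add: w_def step_weight_def)
  qed
  also have "\<dots> = (\<Sum>a\<in>A. \<integral>\<omega>. w a \<omega> * indicator (?H a) \<omega> \<partial>P)"
    by (intro Bochner_Integration.integral_sum integral_past_letter(1) wm w1)
  also have "\<dots> = (\<Sum>a\<in>A. \<integral>\<omega>. w a \<omega> * mass \<omega> a \<partial>P)"
    by (intro sum.cong refl integral_past_letter(3) wm w1)
  also have "\<dots> = (\<integral>\<omega>. (\<Sum>a\<in>A. w a \<omega> * mass \<omega> a) \<partial>P)"
    by (intro Bochner_Integration.integral_sum[symmetric] integral_past_letter(2) wm w1)
  also have "\<dots> = (\<integral>\<omega>. q n * b \<omega> \<partial>P)"
  proof (rule Bochner_Integration.integral_cong[OF refl])
    fix \<omega> assume \<omega>: "\<omega> \<in> space P"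
    \<comment> \<open>The cancellation is also valid where \<open>mass\<close> is 0, because each
      term of the series is then 0 as well.\<close>
    have "w a \<omega> * mass \<omega> a = b \<omega> * q n * of_bool (f n \<omega> = a)" for a
      using step_term_le_mass[of n \<omega> a] q_nonneg[of n] by (cases "mass \<omega> a = 0") (auto simp: w_def of_bool_def)
    then have "(\<Sum>a\<in>A. w a \<omega> * mass \<omega> a) = (\<Sum>a\<in>A. if a = f n \<omega> then b \<omega> * q n else 0)"
      by (intro sum.cong) auto
    also have "\<dots> = q n * b \<omega>" using f_in_A[OF \<omega>] finite_A by simp
    finally show "(\<Sum>a\<in>A. w a \<omega> * mass \<omega> a) = q n * b \<omega>" .
  qed
  finally show ?thesis by simp
qed

section \<open>Paths with independent uniform noise, and the look-back distances drawn from
  them\<close>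

definition noise :: "(int \<Rightarrow> real) measure" where
  "noise = (\<Pi>\<^sub>M i\<in>UNIV. unit_interval)"

definition joint :: "((int \<Rightarrow> 'a) \<times> (int \<Rightarrow> real)) measure" where
  "joint = P \<Otimes>\<^sub>M noise"

definition lookback :: "int \<Rightarrow> (int \<Rightarrow> 'a) \<times> (int \<Rightarrow> real) \<Rightarrow> nat" where
  "lookback i x = quantile (step_weight (\<lambda>j. fst x (j + i))) (snd x i)"

definition hist_space :: "((int \<Rightarrow> 'a) \<times> (int \<Rightarrow> real)) measure" where
  "hist_space = block_space A all_past \<Otimes>\<^sub>M (\<Pi>\<^sub>M i\<in>all_past. unit_interval)"

text \<open>Letters and noise at all negative times. Independence of \<open>lookback 0\<close> is
  proved against this algebra and not just against the past letters, because the earlier look-back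
  distances are measurable with respect to it.\<close>

definition hist :: "((int \<Rightarrow> 'a) \<times> (int \<Rightarrow> real)) measure" where
  "hist = vimage_algebra (space joint) (\<lambda>x. (restrict (fst x) all_past, restrict (snd x) all_past)) hist_space"

lemma prob_space_noise: "prob_space noise"
  unfolding noise_def by (intro prob_space_PiM prob_space_unit_interval)

lemma prob_space_joint: "prob_space joint"
proof -
  interpret N: prob_space noise by (rule prob_space_noise)
  interpret pair_prob_space P noise ..
  show ?thesis unfolding joint_def by unfold_locales
qed

lemma joint_measurable:
  "fst \<in> measurable joint P" "snd \<in> measurable joint noise"
  "(\<lambda>x. fst x i) \<in> measurable joint (count_space A)" "(\<lambda>x. snd x i) \<in> measurable joint unit_interval"
proof -
  show 1: "fst \<in> measurable joint P" "snd \<in> measurable joint noise" by (simp_all add: joint_def)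
  show "(\<lambda>x. fst x i) \<in> measurable joint (count_space A)"
    by (rule measurable_compose[OF 1(1) coord_measurable])
  show "(\<lambda>x. snd x i) \<in> measurable joint unit_interval"
    by (rule measurable_compose[OF 1(2)]) (simp add: noise_def)
qed

lemma unit_interval_borel: "g \<in> measurable K unit_interval \<Longrightarrow> g \<in> borel_measurable K"
  using measurable_restrict_space2_iff[of g K lborel "{0..<1}"] by simp

lemma measurable_hist_map:
  "(\<lambda>x. (restrict (fst x) all_past, restrict (snd x) all_past)) \<in> measurable joint hist_space"
  unfolding hist_space_def
  by (intro measurable_Pair measurable_restrict joint_measurable)

lemma hist_measurable:
  assumes "i < 0"
  shows "(\<lambda>x. fst x i) \<in> measurable hist (count_space A)" "(\<lambda>x. snd x i) \<in> measurable hist unit_interval"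
proof -
  have h: "(\<lambda>x. (restrict (fst x) all_past, restrict (snd x) all_past)) \<in> measurable hist hist_space"
    unfolding hist_def using measurable_hist_map by (intro measurable_vimage_algebra1) (auto simp: measurable_def)
  have c: "(\<lambda>y. y i) \<in> measurable (block_space A all_past) (count_space A)"
    "(\<lambda>y. y i) \<in> measurable (\<Pi>\<^sub>M i\<in>all_past. unit_interval) unit_interval"
    using assms by (intro measurable_component_singleton; simp)+
  have "(\<lambda>y. fst y i) \<in> measurable hist_space (count_space A)" "(\<lambda>y. snd y i) \<in> measurable hist_space unit_interval"
    unfolding hist_space_def by (intro measurable_compose[OF measurable_fst c(1)] measurable_compose[OF measurable_snd c(2)])+
  from this[THEN measurable_compose[OF h]]
  show "(\<lambda>x. fst x i) \<in> measurable hist (count_space A)" "(\<lambda>x. snd x i) \<in> measurable hist unit_interval"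
    using assms by simp_all
qed

lemma hist_events: "B \<in> sets hist \<Longrightarrow> B \<in> sets joint"
  using measurable_hist_map by (auto simp: hist_def measurable_iff_sets)

lemma space_hist: "space hist = space joint"
  by (simp add: hist_def)

lemma space_joint: "space joint = {x. (\<forall>i. fst x i \<in> A) \<and> (\<forall>i. snd x i \<in> {0..<1})}"
proof -
  have "space noise = {u. \<forall>i. u i \<in> {0..<1}}"
    by (simp add: noise_def space_PiM space_restrict_space PiE_UNIV_domain Pi_def)
  then show ?thesis by (auto simp: joint_def space_pair_measure space_P)
qed

lemma lookback_measurable_gen:
  assumes "space K = space joint"
    "\<And>j. j \<le> i \<Longrightarrow> (\<lambda>x. fst x j) \<in> measurable K (count_space A)" "(\<lambda>x. snd x i) \<in> measurable K unit_interval"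
  shows "lookback i \<in> measurable K (count_space UNIV)"
  unfolding lookback_def[abs_def]
proof (intro measurable_quantile measurable_step_weight)
  show "(\<lambda>x j. fst x (j + i)) \<in> space K \<rightarrow> space P"
    using assms(1) by (auto simp: space_joint space_P)
qed (use assms(2,3) unit_interval_borel in auto)

lemma lookback_measurable: "lookback i \<in> measurable joint (count_space UNIV)"
  by (rule lookback_measurable_gen) (auto intro: joint_measurable)

lemma lookback_hist: "i < 0 \<Longrightarrow> lookback i \<in> measurable hist (count_space UNIV)"
  by (rule lookback_measurable_gen) (auto intro: hist_measurable simp: space_hist)

lemma lookback_ge_1: "x \<in> space joint \<Longrightarrow> 1 \<le> lookback i x"
  unfolding lookback_def by (rule quantile_ge_1) (auto simp: step_weight_0 space_joint)

text \<open>Fubini over the path: for a fixed path the noise at time 0 is independent of the earlier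
  noise, so the section of the event has measure \<open>step_weight \<omega> n * b \<omega>\<close>.
  As \<open>b\<close> depends on the past only, \<open>integral_step_weight\<close> replaces the
  weight by \<open>q n\<close>.\<close>

lemma emeasure_lookback_eq_hist:
  assumes B: "B \<in> sets hist"
  shows "emeasure joint ({x \<in> space joint. lookback 0 x = n} \<inter> B) = ennreal (q n) * emeasure joint B"
proof -
  interpret N: prob_space noise by (rule prob_space_noise)
  obtain C where C: "C \<in> sets hist_space"
    "B = (\<lambda>x. (restrict (fst x) all_past, restrict (snd x) all_past)) -` C \<inter> space joint"
    using B measurable_hist_map unfolding hist_def by (auto simp: sets_vimage_algebra2 measurable_def)
  \<comment> \<open>The section of \<open>B\<close> over a path, written through \<open>C\<close> so
    that it visibly depends only on the past of the path.\<close>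
  define sec where "sec \<omega> = {u \<in> space noise. restrict u all_past \<in> Pair (restrict \<omega> all_past) -` C}" for \<omega> :: "int \<Rightarrow> 'a"
  define b where "b \<omega> = N.prob (sec \<omega>)" for \<omega>
  have sp: "space joint = space P \<times> space noise" by (simp add: joint_def space_pair_measure)
  have Csec: "Pair y -` C \<in> sets (\<Pi>\<^sub>M i\<in>all_past. unit_interval)" for y
    using C(1) unfolding hist_space_def by (rule sets_Pair1)
  have b: "b \<in> borel_measurable (past all_past)"
  proof -
    \<comment> \<open>Here the paths are already cut down to the past while the noise is still
      complete. The measure of a section is then a measurable function of the past block, and
      \<open>b\<close> is this function composed with the block map.\<close>
    let ?C = "(\<lambda>x. (fst x, restrict (snd x) all_past)) -` C \<inter> space (block_space A all_past \<Otimes>\<^sub>M noise)"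
    have "(\<lambda>x. (fst x, restrict (snd x) all_past)) \<in> measurable (block_space A all_past \<Otimes>\<^sub>M noise) hist_space"
      unfolding hist_space_def noise_def
      by (intro measurable_Pair measurable_fst measurable_compose[OF measurable_snd] measurable_restrict_subset) auto
    from measurable_sets[OF this C(1)]
    have "(\<lambda>y. emeasure noise (Pair y -` ?C)) \<in> borel_measurable (block_space A all_past)"
      by (rule N.measurable_emeasure_Pair)
    then have "(\<lambda>y. measure noise (Pair y -` ?C)) \<in> borel_measurable (block_space A all_past)"
      unfolding measure_def by measurable
    moreover have bl: "block (\<lambda>i \<omega>. \<omega> i) all_past \<in> measurable (past all_past) (block_space A all_past)"
      unfolding past_def using measurable_block[of "\<lambda>i \<omega>. \<omega> i", OF coord_measurable, of all_past]
      by (intro measurable_vimage_algebra1) (auto simp: measurable_def)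
    ultimately have "(\<lambda>\<omega>. measure noise (Pair (block (\<lambda>i \<omega>. \<omega> i) all_past \<omega>) -` ?C)) \<in> borel_measurable (past all_past)"
      by (rule measurable_compose[rotated])
    moreover have "b \<omega> = measure noise (Pair (block (\<lambda>i \<omega>. \<omega> i) all_past \<omega>) -` ?C)" if "\<omega> \<in> space (past all_past)" for \<omega>
      unfolding b_def sec_def
    proof (rule arg_cong[where f="measure noise"])
      have "restrict \<omega> all_past \<in> space (block_space A all_past)"
        using measurable_space[OF bl that] by (simp add: block_def)
      then show "{u \<in> space noise. restrict u all_past \<in> Pair (restrict \<omega> all_past) -` C} = Pair (block (\<lambda>i \<omega>. \<omega> i) all_past \<omega>) -` ?C"
        by (auto simp: block_def space_pair_measure)
    qed
    ultimately show ?thesis by (subst measurable_cong) auto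
  qed
  have b01: "0 \<le> b \<omega>" "b \<omega> \<le> 1" for \<omega> by (auto simp: b_def)
  have bP: "b \<in> borel_measurable P" by (rule measurable_from_subalg[OF past_subalgebra b])
  have swP: "(\<lambda>\<omega>. step_weight \<omega> n) \<in> borel_measurable P"
    by (rule measurable_step_weight) (auto intro: coord_measurable)
  have "emeasure joint B = (\<integral>\<^sup>+\<omega>. emeasure noise (Pair \<omega> -` B) \<partial>P)"
    using hist_events[OF B] unfolding joint_def by (rule N.emeasure_pair_measure_alt)
  also have "\<dots> = (\<integral>\<^sup>+\<omega>. ennreal (b \<omega>) \<partial>P)"
  proof (rule nn_integral_cong)
    fix \<omega> assume "\<omega> \<in> space P"
    then have "Pair \<omega> -` B = sec \<omega>" by (auto simp: C(2) sec_def sp)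
    then show "emeasure noise (Pair \<omega> -` B) = ennreal (b \<omega>)" by (simp add: b_def N.emeasure_eq_measure)
  qed
  also have "\<dots> = ennreal (\<integral>\<omega>. b \<omega> \<partial>P)"
    by (rule nn_integral_eq_integral_bounded[OF bP b01])
  finally have eB: "emeasure joint B = ennreal (\<integral>\<omega>. b \<omega> \<partial>P)" .
  let ?D = "{x \<in> space joint. lookback 0 x = n} \<inter> B"
  have "{x \<in> space joint. lookback 0 x = n} = lookback 0 -` {n} \<inter> space joint" by auto
  then have "?D \<in> sets joint" using measurable_sets[OF lookback_measurable, of "{n}" 0] hist_events[OF B] by auto
  then have "emeasure joint ?D = (\<integral>\<^sup>+\<omega>. emeasure noise (Pair \<omega> -` ?D) \<partial>P)"
    unfolding joint_def by (rule N.emeasure_pair_measure_alt)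
  also have "\<dots> = (\<integral>\<^sup>+\<omega>. ennreal (step_weight \<omega> n * b \<omega>) \<partial>P)"
  proof (rule nn_integral_cong_AE)
    show "AE \<omega> in P. emeasure noise (Pair \<omega> -` ?D) = ennreal (step_weight \<omega> n * b \<omega>)"
      using AE_step_weight_sums AE_space
    proof eventually_elim
      case (elim \<omega>)
      let ?S = "{t \<in> {0..<1}. quantile (step_weight \<omega>) t = n}"
      have "Pair \<omega> -` ?D = {u \<in> space noise. u 0 \<in> ?S \<and> restrict u all_past \<in> Pair (restrict \<omega> all_past) -` C}"
        using elim(2) by (auto simp: C(2) space_joint joint_def space_pair_measure lookback_def noise_def space_PiM space_restrict_space)
      also have "emeasure noise \<dots> = emeasure unit_interval ?S * emeasure noise (sec \<omega>)"
        unfolding noise_def sec_def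
        by (rule emeasure_PiM_coordinate_indep[OF prob_space_unit_interval emeasure_quantile(1) Csec])
          (auto simp: step_weight_nonneg elim)
      also have "emeasure unit_interval ?S = ennreal (step_weight \<omega> n)"
        by (rule emeasure_quantile(2)) (auto simp: step_weight_nonneg elim)
      finally show ?case
        by (simp add: b_def N.emeasure_eq_measure ennreal_mult step_weight_nonneg)
    qed
  qed
  also have "\<dots> = ennreal (\<integral>\<omega>. step_weight \<omega> n * b \<omega> \<partial>P)"
    using bP swP b01 step_weight_nonneg step_weight_le_1
    by (intro nn_integral_eq_integral_bounded borel_measurable_times mult_nonneg_nonneg mult_le_one) auto
  also have "\<dots> = ennreal (q n) * emeasure joint B"
    by (simp add: integral_step_weight[OF b b01] eB ennreal_mult q_nonneg b01)
  finally show ?thesis .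
qed

text \<open>Countable additivity over the values in \<open>S\<close>; the whole space in place of
  \<open>B\<close> identifies the first factor.\<close>

lemma emeasure_lookback_hist:
  assumes B: "B \<in> sets hist"
  shows "emeasure joint ({x \<in> space joint. lookback 0 x \<in> S} \<inter> B)
    = emeasure joint {x \<in> space joint. lookback 0 x \<in> S} * emeasure joint B"
proof -
  interpret J: prob_space joint by (rule prob_space_joint)
  have *: "emeasure joint ({x \<in> space joint. lookback 0 x \<in> S} \<inter> B)
    = (\<integral>\<^sup>+n. ennreal (q n) \<partial>count_space S) * emeasure joint B" if B: "B \<in> sets hist" for B
  proof -
    let ?D = "\<lambda>n. {x \<in> space joint. lookback 0 x = n} \<inter> B"
    have "{x \<in> space joint. lookback 0 x = n} = lookback 0 -` {n} \<inter> space joint" for n by auto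
    then have D: "?D n \<in> sets joint" for n
      using measurable_sets[OF lookback_measurable, of "{n}" 0] hist_events[OF B] by auto
    have "{x \<in> space joint. lookback 0 x \<in> S} \<inter> B = (\<Union>n\<in>S. ?D n)" by auto
    also have "emeasure joint \<dots> = (\<integral>\<^sup>+n. emeasure joint (?D n) \<partial>count_space S)"
      by (rule emeasure_UN_countable) (use D in \<open>auto simp: disjoint_family_on_def\<close>)
    also have "\<dots> = (\<integral>\<^sup>+n. ennreal (q n) * emeasure joint B \<partial>count_space S)"
      by (simp only: emeasure_lookback_eq_hist[OF B])
    also have "\<dots> = (\<integral>\<^sup>+n. ennreal (q n) \<partial>count_space S) * emeasure joint B"
      by (rule nn_integral_multc) simp
    finally show ?thesis .
  qed
  have "space joint \<in> sets hist" using sets.top[of hist] by (simp add: space_hist)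
  from *[OF this] have "emeasure joint {x \<in> space joint. lookback 0 x \<in> S} = (\<integral>\<^sup>+n. ennreal (q n) \<partial>count_space S)"
    by (simp add: J.emeasure_space_1 Int_absorb2 Collect_subset flip: Collect_conj_eq)
  then show ?thesis using *[OF B] by simp
qed

section \<open>Shift invariance, and independence of the look-back distances at different
  times\<close>

definition shift :: "int \<Rightarrow> (int \<Rightarrow> 'a) \<times> (int \<Rightarrow> real) \<Rightarrow> (int \<Rightarrow> 'a) \<times> (int \<Rightarrow> real)" where
  "shift k x = (\<lambda>i. fst x (i + k), \<lambda>i. snd x (i + k))"

lemma distr_shift: "distr joint joint (shift k) = joint"
  and measurable_shift: "shift k \<in> measurable joint joint"
proof -
  interpret N: prob_space noise by (rule prob_space_noise)
  have n: "distr noise noise (\<lambda>u i. u (i + k)) = noise"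
    using distr_PiM_reindex[of UNIV "\<lambda>_. unit_interval" "\<lambda>i. i + k" "UNIV::int set"]
    by (simp add: noise_def prob_space_unit_interval restrict_UNIV)
  have m: "(\<lambda>\<omega> i. \<omega> (i + k)) \<in> measurable P P" by (rule measurable_into_P) (rule coord_measurable)
  have m': "(\<lambda>u i. u (i + k)) \<in> measurable noise noise"
    unfolding noise_def by (rule measurable_path[where X="\<lambda>i u. u (i + k)"]) simp
  have s: "shift k = (\<lambda>(\<omega>, u). ((\<lambda>i. \<omega> (i + k)), (\<lambda>i. u (i + k))))"
    by (auto simp: shift_def fun_eq_iff)
  show "shift k \<in> measurable joint joint"
    unfolding shift_def joint_def
    by (intro measurable_Pair measurable_compose[OF measurable_fst m] measurable_compose[OF measurable_snd m'])
  show "distr joint joint (shift k) = joint"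
    using pair_measure_distr[OF m m'] unfolding n shift_P s joint_def
    by (simp add: N.sigma_finite_measure_axioms)
qed

lemma lookback_shift: "lookback i (shift k x) = lookback (i + k) x"
  by (simp add: lookback_def shift_def add.assoc)

lemma lookback_event: "{x \<in> space joint. \<forall>j\<in>J. lookback (j + k) x \<in> S j} \<in> sets joint" if "finite J"
  using that
proof (induction J)
  case (insert j J)
  have "{x \<in> space joint. \<forall>i\<in>insert j J. lookback (i + k) x \<in> S i}
    = (lookback (j + k) -` S j \<inter> space joint) \<inter> {x \<in> space joint. \<forall>j\<in>J. lookback (j + k) x \<in> S j}" by auto
  also have "\<dots> \<in> sets joint"
    using insert.IH measurable_sets[OF lookback_measurable, of "S j"] by auto
  finally show ?case .
qed simp

lemma emeasure_lookback_shift: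
  assumes "finite J"
  shows "emeasure joint {x \<in> space joint. \<forall>j\<in>J. lookback (j + k) x \<in> S j}
    = emeasure joint {x \<in> space joint. \<forall>j\<in>J. lookback j x \<in> S j}"
proof -
  have E: "{x \<in> space joint. \<forall>j\<in>J. lookback j x \<in> S j} \<in> sets joint"
    using lookback_event[OF assms, of 0] by simp
  have "emeasure joint {x \<in> space joint. \<forall>j\<in>J. lookback j x \<in> S j}
    = emeasure (distr joint joint (shift k)) {x \<in> space joint. \<forall>j\<in>J. lookback j x \<in> S j}"
    by (simp add: distr_shift)
  also have "\<dots> = emeasure joint {x \<in> space joint. \<forall>j\<in>J. lookback (j + k) x \<in> S j}"
    using measurable_space[OF measurable_shift] 
    by (subst emeasure_distr[OF measurable_shift E]) (auto simp: lookback_shift intro!: arg_cong[where f="emeasure _"])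
  finally show ?thesis ..
qed

text \<open>Induction on the largest index. A shift moves it to 0; the other indices become
  negative, so their condition is an event of the history and splits off as a factor.\<close>

lemma emeasure_lookback_prod:
  assumes "finite J"
  shows "emeasure joint {x \<in> space joint. \<forall>j\<in>J. lookback j x \<in> S j}
    = (\<Prod>j\<in>J. emeasure joint {x \<in> space joint. lookback j x \<in> S j})"
  using assms
proof (induction J rule: finite_linorder_max_induct)
  case empty
  interpret J: prob_space joint by (rule prob_space_joint)
  show ?case by (simp add: J.emeasure_space_1)
next
  case (insert b J)
  let ?B = "{x \<in> space joint. \<forall>j\<in>J. lookback (j + - b) x \<in> S j}"
  have "?B = (\<Inter>j\<in>J. lookback (j + - b) -` S j \<inter> space hist) \<inter> space hist"
    by (auto simp: space_hist)
  also have "\<dots> \<in> sets hist"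
  proof (cases "J = {}")
    case False
    have "lookback (j + - b) -` S j \<inter> space hist \<in> sets hist" if "j \<in> J" for j
      using insert that by (intro measurable_sets[OF lookback_hist]) auto
    then show ?thesis by (intro sets.Int[OF sets.finite_INT[OF insert(1) False] sets.top])
  qed simp
  finally have B: "?B \<in> sets hist" .
  have b: "emeasure joint {x \<in> space joint. lookback 0 x \<in> S b} = emeasure joint {x \<in> space joint. lookback b x \<in> S b}"
    using emeasure_lookback_shift[of "{b}" "- b" S] by simp
  have "emeasure joint {x \<in> space joint. \<forall>j\<in>insert b J. lookback j x \<in> S j}
    = emeasure joint {x \<in> space joint. \<forall>j\<in>insert b J. lookback (j + - b) x \<in> S j}"
    using insert(1) by (intro emeasure_lookback_shift[symmetric]) simp
  also have "{x \<in> space joint. \<forall>j\<in>insert b J. lookback (j + - b) x \<in> S j} = {x \<in> space joint. lookback 0 x \<in> S b} \<inter> ?B"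
    by auto
  also have "emeasure joint \<dots> = emeasure joint {x \<in> space joint. lookback 0 x \<in> S b} * emeasure joint ?B"
    by (rule emeasure_lookback_hist[OF B])
  also have "emeasure joint ?B = emeasure joint {x \<in> space joint. \<forall>j\<in>J. lookback j x \<in> S j}"
    by (rule emeasure_lookback_shift[OF insert(1)])
  finally show ?case using insert by (subst prod.insert) (auto simp: b)
qed

lemma distr_joint_fst: "distr joint P fst = P"
proof -
  interpret N: prob_space noise by (rule prob_space_noise)
  show ?thesis unfolding joint_def by (rule N.distr_pair_fst)
qed

text \<open>A drawn value has nonzero weight, and the weight of \<open>n\<close> vanishes unless
  \<open>f n\<close> predicts the present letter.\<close>

lemma AE_joint_letter: "AE x in joint. lookback 0 x = n \<longrightarrow> f n (fst x) = fst x 0"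
proof -
  have "AE \<omega> in distr joint P fst. step_weight \<omega> sums 1" by (simp only: distr_joint_fst AE_step_weight_sums)
  then have "AE x in joint. step_weight (fst x) sums 1"
    by (rule AE_distrD[OF joint_measurable(1)])
  then show ?thesis using AE_space
  proof eventually_elim
    case (elim x)
    have t: "0 \<le> snd x 0" "snd x 0 < 1" using elim(2) by (auto simp: space_joint)
    show ?case
    proof
      assume "lookback 0 x = n"
      then have "quantile (step_weight (fst x)) (snd x 0) = n" by (simp add: lookback_def)
      then have "step_weight (fst x) n \<noteq> 0"
        using quantile_eq_iff[of "step_weight (fst x)" "snd x 0" n] step_weight_nonneg elim(1) t by auto
      then show "f n (fst x) = fst x 0" by (auto simp: step_weight_def)
    qed
  qed
qed

section \<open>The coupling as a law on pairs of paths, with the noise discarded\<close>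

definition coupling :: "'a coupling_space measure" where
  "coupling = distr joint ((\<Pi>\<^sub>M i\<in>UNIV. count_space A) \<Otimes>\<^sub>M (\<Pi>\<^sub>M i\<in>UNIV. count_space {1..}))
     (\<lambda>x. (fst x, \<lambda>i. lookback i x))"

lemma lookback_measurable': "lookback i \<in> measurable joint (count_space {1..})"
proof (rule measurableI)
  fix x assume "x \<in> space joint"
  then show "lookback i x \<in> space (count_space {1..})" using lookback_ge_1 by simp
next
  fix S assume "S \<in> sets (count_space {1::nat..})"
  then show "lookback i -` S \<inter> space joint \<in> sets joint"
    by (intro measurable_sets[OF lookback_measurable]) simp
qed

lemma coupling_map_measurable:
  "(\<lambda>x. (fst x, \<lambda>i. lookback i x)) \<in> measurable joint
     ((\<Pi>\<^sub>M i\<in>UNIV. count_space A) \<Otimes>\<^sub>M (\<Pi>\<^sub>M i\<in>UNIV. count_space {1..}))"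
  using joint_measurable(3) lookback_measurable' by (intro measurable_Pair measurable_path)

lemma prob_space_coupling: "prob_space coupling"
  unfolding coupling_def using prob_space_joint coupling_map_measurable by (rule prob_space.prob_space_distr)

lemma coupling_measurable:
  "(\<lambda>v. fst v i) \<in> measurable coupling (count_space A)" "(\<lambda>v. snd v i) \<in> measurable coupling (count_space {1..})"
proof -
  have "(\<lambda>v. fst v i) \<in> measurable ((\<Pi>\<^sub>M i\<in>UNIV. count_space A) \<Otimes>\<^sub>M (\<Pi>\<^sub>M i\<in>UNIV. count_space {1..})) (count_space A)"
    by (rule measurable_compose[OF measurable_fst]) simp
  then show "(\<lambda>v. fst v i) \<in> measurable coupling (count_space A)" by (simp add: coupling_def)
  have "(\<lambda>v. snd v i) \<in> measurable ((\<Pi>\<^sub>M i\<in>UNIV. count_space A) \<Otimes>\<^sub>M (\<Pi>\<^sub>M i\<in>UNIV. count_space {1..})) (count_space {1..})"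
    by (rule measurable_compose[OF measurable_snd]) simp
  then show "(\<lambda>v. snd v i) \<in> measurable coupling (count_space {1..})" by (simp add: coupling_def)
qed

lemma measure_coupling:
  assumes "{v \<in> space coupling. R v} \<in> sets coupling"
  shows "measure coupling {v \<in> space coupling. R v} = measure joint {x \<in> space joint. R (fst x, \<lambda>i. lookback i x)}"
proof -
  have *: "{v \<in> space coupling. R v} \<in> sets ((\<Pi>\<^sub>M i\<in>UNIV. count_space A) \<Otimes>\<^sub>M (\<Pi>\<^sub>M i\<in>UNIV. count_space {1..}))"
    using assms by (simp add: coupling_def)
  show ?thesis
    unfolding coupling_def
    by (subst measure_distr[OF coupling_map_measurable])
      (use * measurable_space[OF coupling_map_measurable] in \<open>auto simp: coupling_def intro!: arg_cong[where f="measure _"]\<close>)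
qed

lemma process_law_coupling:
  assumes g: "\<And>i. (\<lambda>v. g v i) \<in> measurable coupling S"
  shows "process_law coupling S (\<lambda>i v. g v i) = distr joint (\<Pi>\<^sub>M i\<in>UNIV. S) (\<lambda>x. g (fst x, \<lambda>i. lookback i x))"
proof -
  have "g \<in> measurable coupling (\<Pi>\<^sub>M i\<in>UNIV. S)" using measurable_path[of "\<lambda>i v. g v i", OF g] by simp
  then have "g \<in> measurable ((\<Pi>\<^sub>M i\<in>UNIV. count_space A) \<Otimes>\<^sub>M (\<Pi>\<^sub>M i\<in>UNIV. count_space {1..})) (\<Pi>\<^sub>M i\<in>UNIV. S)"
    by (simp add: coupling_def)
  from distr_distr[OF this coupling_map_measurable] show ?thesis
    by (simp add: process_law_def coupling_def comp_def)
qed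

text \<open>\<open>lookback\<close> commutes with the shift, so the invariance of
  \<open>joint\<close> carries over to letters and look-back distances jointly.\<close>

lemma coupling_stationary:
  "stationary_process coupling (count_space A \<Otimes>\<^sub>M count_space {1..}) (\<lambda>i v. (fst v i, snd v i))"
  unfolding stationary_process_def
proof (intro conjI allI prob_space_coupling)
  let ?S = "count_space A \<Otimes>\<^sub>M count_space {1::nat..}"
  show m: "(\<lambda>v. (fst v i, snd v i)) \<in> measurable coupling ?S" for i
    by (intro measurable_Pair coupling_measurable)
  fix k
  let ?g = "\<lambda>x i. (fst x i, lookback i x)"
  have g: "?g \<in> measurable joint (\<Pi>\<^sub>M i\<in>UNIV. ?S)"
    by (intro measurable_path[where X="\<lambda>i x. (fst x i, lookback i x)"] measurable_Pair joint_measurable lookback_measurable')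
  have "process_law coupling ?S (\<lambda>i v. (fst v (i + k), snd v (i + k)))
    = distr joint (\<Pi>\<^sub>M i\<in>UNIV. ?S) (\<lambda>x i. (fst x (i + k), lookback (i + k) x))"
    using process_law_coupling[of "\<lambda>v i. (fst v (i + k), snd v (i + k))", OF m] by simp
  also have "\<dots> = distr (distr joint joint (shift k)) (\<Pi>\<^sub>M i\<in>UNIV. ?S) ?g"
    by (subst distr_distr[OF g measurable_shift]) (simp add: comp_def lookback_shift, simp add: shift_def)
  also have "\<dots> = distr joint (\<Pi>\<^sub>M i\<in>UNIV. ?S) ?g" by (simp add: distr_shift)
  also have "\<dots> = process_law coupling ?S (\<lambda>i v. (fst v i, snd v i))"
    using process_law_coupling[of "\<lambda>v i. (fst v i, snd v i)", OF m] by simp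
  finally show "process_law coupling ?S (\<lambda>i v. (fst v (i + k), snd v (i + k)))
    = process_law coupling ?S (\<lambda>i v. (fst v i, snd v i))" .
qed

lemma coupling_law: "process_law coupling (count_space A) (\<lambda>i v. fst v i) = P"
proof -
  have "process_law coupling (count_space A) (\<lambda>i v. fst v i) = distr joint (\<Pi>\<^sub>M i\<in>UNIV. count_space A) fst"
    using process_law_coupling[of fst, OF coupling_measurable(1)] by simp
  also have "\<dots> = distr joint P fst" by (rule distr_cong) (simp_all add: sets_P)
  finally show ?thesis by (simp add: distr_joint_fst)
qed

lemma coupling_indep_vars: "prob_space.indep_vars coupling (\<lambda>_. count_space {1..}) (\<lambda>i v. snd v i) UNIV"
proof -
  interpret C: prob_space coupling by (rule prob_space_coupling)
  interpret J: prob_space joint by (rule prob_space_joint)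
  show ?thesis unfolding C.indep_vars_def2
  proof (intro conjI ballI C.indep_setsI)
    fix i :: int
    show "(\<lambda>v. snd v i) \<in> measurable coupling (count_space {1..})" by (rule coupling_measurable)
    show "{(\<lambda>v. snd v i) -` B \<inter> space coupling |B. B \<in> sets (count_space {1..})} \<subseteq> C.events"
      using measurable_sets[OF coupling_measurable(2)] by auto
  next
    fix B :: "int \<Rightarrow> 'a coupling_space set" and J :: "int set"
    assume J: "J \<noteq> {}" "finite J"
      and BJ: "\<forall>j\<in>J. B j \<in> {(\<lambda>v. snd v j) -` S \<inter> space coupling |S. S \<in> sets (count_space {1::nat..})}"
    have "\<forall>j\<in>J. \<exists>S. B j = (\<lambda>v. snd v j) -` S \<inter> space coupling"
    proof
      fix j assume "j \<in> J"
      with BJ have "B j \<in> {(\<lambda>v. snd v j) -` S \<inter> space coupling |S. S \<in> sets (count_space {1::nat..})}" ..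
      then show "\<exists>S. B j = (\<lambda>v. snd v j) -` S \<inter> space coupling" by blast
    qed
    from bchoice[OF this] obtain S where "\<forall>j\<in>J. B j = (\<lambda>v. snd v j) -` S j \<inter> space coupling" ..
    moreover have "(\<lambda>v. snd v j) -` T \<inter> space coupling = {v \<in> space coupling. snd v j \<in> T}" for j T by auto
    ultimately have S: "\<And>j. j \<in> J \<Longrightarrow> B j = {v \<in> space coupling. snd v j \<in> S j}" by simp
    have ev: "{v \<in> space coupling. snd v j \<in> T} \<in> C.events" for j T
    proof -
      have "{v \<in> space coupling. snd v j \<in> T} = (\<lambda>v. snd v j) -` (T \<inter> {1..}) \<inter> space coupling"
        using measurable_space[OF coupling_measurable(2)] by auto
      then show ?thesis using measurable_sets[OF coupling_measurable(2), of "T \<inter> {1..}" j] by simp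
    qed
    have "(\<Inter>j\<in>J. B j) = (\<Inter>j\<in>J. {v \<in> space coupling. snd v j \<in> S j})"
      by (intro INF_cong refl S)
    also have "\<dots> = {v \<in> space coupling. \<forall>j\<in>J. snd v j \<in> S j}" using J(1) by blast
    finally have int: "(\<Inter>j\<in>J. B j) = {v \<in> space coupling. \<forall>j\<in>J. snd v j \<in> S j}" .
    have "(\<Inter>j\<in>J. {v \<in> space coupling. snd v j \<in> S j}) \<in> C.events"
      by (rule sets.finite_INT[OF J(2,1) ev])
    also have "(\<Inter>j\<in>J. {v \<in> space coupling. snd v j \<in> S j}) = {v \<in> space coupling. \<forall>j\<in>J. snd v j \<in> S j}"
      using J(1) by blast
    finally have "C.prob (\<Inter>j\<in>J. B j) = J.prob {x \<in> space joint. \<forall>j\<in>J. lookback j x \<in> S j}"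
      unfolding int by (subst measure_coupling) simp_all
    also have "\<dots> = (\<Prod>j\<in>J. J.prob {x \<in> space joint. lookback j x \<in> S j})"
      using emeasure_lookback_prod[OF J(2), of S]
      unfolding J.emeasure_eq_measure by (subst (asm) prod_ennreal) (simp_all add: prod_nonneg)
    also have "\<dots> = (\<Prod>j\<in>J. C.prob (B j))"
    proof (rule prod.cong[OF refl])
      fix j assume "j \<in> J"
      show "J.prob {x \<in> space joint. lookback j x \<in> S j} = C.prob (B j)"
        unfolding S[OF \<open>j \<in> J\<close>] by (subst measure_coupling[OF ev]) simp
    qed
    finally show "C.prob (\<Inter>j\<in>J. B j) = (\<Prod>j\<in>J. C.prob (B j))" .
  qed
qed

text \<open>An event of the past letters is an event of the history, from which
  \<open>lookback 0\<close> is independent.\<close>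

lemma coupling_indep_set:
  "prob_space.indep_set coupling
     (sets (vimage_algebra (space coupling) (\<lambda>v. snd v 0) (count_space {1..})))
     (sets (vimage_algebra (space coupling) (block (\<lambda>i v. fst v i) all_past) (block_space A all_past)))"
proof -
  interpret C: prob_space coupling by (rule prob_space_coupling)
  interpret J: prob_space joint by (rule prob_space_joint)
  let ?b = "block (\<lambda>i v. fst v i) all_past :: 'a coupling_space \<Rightarrow> _"
  have bm: "?b \<in> measurable coupling (block_space A all_past)"
    by (intro measurable_block coupling_measurable)
  have lm: "(\<lambda>v. snd v 0) \<in> measurable coupling (count_space {1..})" by (rule coupling_measurable)
  show ?thesis
  proof (rule C.indep_setI)
    show "sets (vimage_algebra (space coupling) (\<lambda>v. snd v 0) (count_space {1..})) \<subseteq> C.events"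
      "sets (vimage_algebra (space coupling) ?b (block_space A all_past)) \<subseteq> C.events"
      using bm lm by (auto simp: measurable_iff_sets)
    fix a b
    assume a: "a \<in> sets (vimage_algebra (space coupling) (\<lambda>v. snd v 0) (count_space {1::nat..}))"
      and b: "b \<in> sets (vimage_algebra (space coupling) ?b (block_space A all_past))"
    from a have ae: "a \<in> C.events" using lm by (auto simp: measurable_iff_sets)
    from b have be: "b \<in> C.events" using bm by (auto simp: measurable_iff_sets)
    from a lm obtain S where S: "a = {v \<in> space coupling. snd v 0 \<in> S}"
      by (auto simp: sets_vimage_algebra2 measurable_def)
    from b bm obtain D where D: "D \<in> sets (block_space A all_past)" "b = {v \<in> space coupling. ?b v \<in> D}"
      by (auto simp: sets_vimage_algebra2 measurable_def)
    let ?B = "{x \<in> space joint. restrict (fst x) all_past \<in> D}"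
    have "(\<lambda>x. restrict (fst x) all_past) \<in> measurable hist (block_space A all_past)"
      by (intro measurable_restrict hist_measurable) simp
    from measurable_sets[OF this D(1)]
    have "(\<lambda>x. restrict (fst x) all_past) -` D \<inter> space joint \<in> sets hist" by (simp add: space_hist)
    also have "(\<lambda>x. restrict (fst x) all_past) -` D \<inter> space joint = ?B" by auto
    finally have B: "?B \<in> sets hist" .
    have "a \<inter> b = {v \<in> space coupling. snd v 0 \<in> S \<and> ?b v \<in> D}" using S D by auto
    then have "C.prob (a \<inter> b) = J.prob {x \<in> space joint. lookback 0 x \<in> S \<and> restrict (fst x) all_past \<in> D}"
      using sets.Int[OF ae be] by (simp add: measure_coupling) (simp add: block_def)
    also have "{x \<in> space joint. lookback 0 x \<in> S \<and> restrict (fst x) all_past \<in> D} = {x \<in> space joint. lookback 0 x \<in> S} \<inter> ?B"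
      by auto
    also have "J.prob \<dots> = J.prob {x \<in> space joint. lookback 0 x \<in> S} * J.prob ?B"
      using emeasure_lookback_hist[OF B, of S] by (simp add: J.emeasure_eq_measure flip: ennreal_mult)
    also have "J.prob {x \<in> space joint. lookback 0 x \<in> S} = C.prob a"
      using ae by (simp add: measure_coupling S)
    also have "J.prob ?B = C.prob b"
      using be by (simp add: measure_coupling D(2)) (simp add: block_def)
    finally show "C.prob (a \<inter> b) = C.prob a * C.prob b" .
  qed
qed

lemma AE_coupling_letter: "AE v in coupling. snd v 0 = n \<longrightarrow> f n (fst v) = fst v 0"
proof -
  let ?S = "(\<Pi>\<^sub>M i\<in>(UNIV::int set). count_space A) \<Otimes>\<^sub>M (\<Pi>\<^sub>M i\<in>(UNIV::int set). count_space {1::nat..})"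
  have fst: "fst \<in> measurable coupling P"
    by (rule measurable_into_P) (rule coupling_measurable)
  have "(\<lambda>v. f n (fst v)) \<in> measurable coupling (count_space A)"
    by (rule measurable_compose[OF fst measurable_from_subalg[OF past_subalgebra f_past]])
  then have "Measurable.pred coupling (\<lambda>v. f n (fst v) = fst v 0)"
    by (rule pred_eq_finite_count_space[OF finite_A _ coupling_measurable(1)])
  moreover have "Measurable.pred coupling (\<lambda>v. snd v 0 = n)"
    by (rule measurable_compose[OF coupling_measurable(2), of "\<lambda>m. m = n"]) simp
  ultimately have "Measurable.pred coupling (\<lambda>v. snd v 0 = n \<longrightarrow> f n (fst v) = fst v 0)" by measurable
  then have "{v \<in> space ?S. snd v 0 = n \<longrightarrow> f n (fst v) = fst v 0} \<in> sets ?S"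
    by (simp add: pred_def coupling_def)
  then show ?thesis
    unfolding coupling_def using AE_joint_letter by (subst AE_distr_iff[OF coupling_map_measurable]) auto
qed

text \<open>The last \<open>n\<close> letters determine the prediction \<open>f n\<close>, which is
  almost surely correct when the distance is \<open>n\<close>. Admitting any larger block
  \<open>J\<close> covers both the recent and the whole past.\<close>

lemma coupling_cond_law:
  assumes n: "1 \<le> n" and E: "E \<subseteq> A" and J: "recent_past n \<subseteq> J"
  shows "AE v in coupling. snd v 0 = n \<longrightarrow>
    cond_law_lookback coupling A (\<lambda>i v. fst v i) (\<lambda>i v. snd v i) J v E = indicator E (f n (fst v))"
proof (rule cond_law_lookback_determined[where Y="\<lambda>i v. fst v i" and L="\<lambda>i v. snd v i" and g="\<lambda>v. f n (fst v)",
      OF prob_space_coupling coupling_measurable n E _ AE_coupling_letter])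
  let ?F = "vimage_algebra (space coupling) (block (\<lambda>i v. fst v i) J) (block_space A J)"
  have b: "block (\<lambda>i v. fst v i) J \<in> measurable ?F (block_space A J)"
    using measurable_block[of "\<lambda>i v. fst v i", OF coupling_measurable(1), of J]
    by (intro measurable_vimage_algebra1) (auto simp: measurable_def)
  have c: "(\<lambda>v. fst v j) \<in> measurable ?F (count_space A)" if "j \<in> J" for j
  proof -
    have "(\<lambda>v. block (\<lambda>i v. fst v i) J v j) \<in> measurable ?F (count_space A)"
      by (rule measurable_compose[OF b measurable_component_singleton[OF that]])
    then show ?thesis using that by (simp add: block_def)
  qed
  show "(\<lambda>v. f n (fst v)) \<in> measurable ?F (count_space A)"
  proof (rule measurable_compose[OF measurable_into_past f_meas[folded past_def]])
    show "fst \<in> space ?F \<rightarrow> space P"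
      using measurable_space[OF coupling_measurable(1)] by (auto simp: space_P)
  qed (use c J in auto)
qed

text \<open>Given distance \<open>n\<close>, the conditional laws under the recent and the whole
  past are the same indicator, which yields both their equality and the values 0 and 1.\<close>

lemma coupling_representation:
  assumes "stationary_process M (count_space A) X" "process_law M (count_space A) X = P"
  shows "deterministic_representation M A X coupling (\<lambda>i v. fst v i) (\<lambda>i v. snd v i)"
proof -
  have eq: "AE v in coupling. snd v 0 = n \<longrightarrow>
      cond_law_lookback coupling A (\<lambda>i v. fst v i) (\<lambda>i v. snd v i) (recent_past n) v E
      = cond_law_lookback coupling A (\<lambda>i v. fst v i) (\<lambda>i v. snd v i) all_past v E \<and>
      cond_law_lookback coupling A (\<lambda>i v. fst v i) (\<lambda>i v. snd v i) (recent_past n) v E \<in> {0, 1}"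
    if "1 \<le> n" "E \<subseteq> A" for n E
  proof -
    have "AE v in coupling. snd v 0 = n \<longrightarrow>
      cond_law_lookback coupling A (\<lambda>i v. fst v i) (\<lambda>i v. snd v i) all_past v E = indicator E (f n (fst v))"
      by (rule coupling_cond_law[OF that]) auto
    with coupling_cond_law[OF that order_refl] show ?thesis
      by eventually_elim (auto simp: indicator_def)
  qed
  have "complete_rsm_representation M A X coupling (\<lambda>i v. fst v i) (\<lambda>i v. snd v i)"
    unfolding complete_rsm_representation_def
  proof (intro conjI allI impI assms(1) coupling_stationary coupling_indep_vars coupling_indep_set)
    show "process_law coupling (count_space A) (\<lambda>i v. fst v i) = process_law M (count_space A) X"
      by (simp add: coupling_law assms)
    show "AE v in coupling. snd v 0 = n \<longrightarrow>
      cond_law_lookback coupling A (\<lambda>i v. fst v i) (\<lambda>i v. snd v i) (recent_past n) v E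
      = cond_law_lookback coupling A (\<lambda>i v. fst v i) (\<lambda>i v. snd v i) all_past v E" if "1 \<le> n" "E \<subseteq> A" for n E
      using eq[OF that] by eventually_elim blast
  qed
  moreover have "AE v in coupling. snd v 0 = n \<longrightarrow>
      cond_law_lookback coupling A (\<lambda>i v. fst v i) (\<lambda>i v. snd v i) all_past v {a}
      = cond_law_lookback coupling A (\<lambda>i v. fst v i) (\<lambda>i v. snd v i) (recent_past n) v {a} \<and>
      cond_law_lookback coupling A (\<lambda>i v. fst v i) (\<lambda>i v. snd v i) (recent_past n) v {a} \<in> {0, 1}"
    if "1 \<le> n" "a \<in> A" for n a
  proof -
    have "{a} \<subseteq> A" using that by simp
    from eq[OF that(1) this] show ?thesis by eventually_elim metis
  qed
  ultimately show ?thesis unfolding deterministic_representation_def by blast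
qed

text \<open>The look-back distance has distribution \<open>q\<close>, and its expectation is the sum
  of its tail probabilities.\<close>

lemma expected_lookback_coupling:
  "(\<integral>\<^sup>+ v. of_nat (snd v 0) \<partial>coupling) = (\<Sum>n. ennreal (1 - (\<Sum>m<Suc n. q m)))"
proof -
  interpret C: prob_space coupling by (rule prob_space_coupling)
  interpret J: prob_space joint by (rule prob_space_joint)
  have l: "(\<lambda>v. snd v 0) \<in> measurable coupling (count_space UNIV)"
    by (rule measurable_compose[OF coupling_measurable(2), of "\<lambda>m. m"]) simp
  have ev: "{x \<in> space joint. lookback 0 x = m} \<in> J.events" for m
  proof -
    have "{x \<in> space joint. lookback 0 x = m} = lookback 0 -` {m} \<inter> space joint" by auto
    then show ?thesis using measurable_sets[OF lookback_measurable, of "{m}" 0] by simp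
  qed
  have qm: "J.prob {x \<in> space joint. lookback 0 x = m} = q m" for m
  proof -
    have "space joint \<in> sets hist" using sets.top[of hist] by (simp add: space_hist)
    moreover have "{x \<in> space joint. lookback 0 x = m} \<inter> space joint = {x \<in> space joint. lookback 0 x = m}" by auto
    ultimately have "emeasure joint {x \<in> space joint. lookback 0 x = m} = ennreal (q m)"
      using emeasure_lookback_eq_hist[of "space joint" m] by (simp add: J.emeasure_space_1)
    then show ?thesis by (simp add: J.emeasure_eq_measure q_nonneg)
  qed
  have "emeasure coupling {v \<in> space coupling. n < snd v 0} = ennreal (1 - (\<Sum>m<Suc n. q m))" for n
  proof -
    have "{v \<in> space coupling. n < snd v 0} = (\<lambda>v. snd v 0) -` {n<..} \<inter> space coupling" by auto
    then have "{v \<in> space coupling. n < snd v 0} \<in> C.events" using measurable_sets[OF l, of "{n<..}"] by simp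
    then have "C.prob {v \<in> space coupling. n < snd v 0} = J.prob {x \<in> space joint. n < lookback 0 x}"
      by (simp add: measure_coupling)
    also have "{x \<in> space joint. n < lookback 0 x} = space joint - (\<Union>m\<in>{..<Suc n}. {x \<in> space joint. lookback 0 x = m})"
      by auto
    also have "J.prob \<dots> = 1 - J.prob (\<Union>m\<in>{..<Suc n}. {x \<in> space joint. lookback 0 x = m})"
      by (intro J.prob_compl sets.finite_UN ev) simp
    also have "J.prob (\<Union>m\<in>{..<Suc n}. {x \<in> space joint. lookback 0 x = m}) = (\<Sum>m<Suc n. J.prob {x \<in> space joint. lookback 0 x = m})"
      by (intro J.finite_measure_finite_Union) (use ev in \<open>auto simp: disjoint_family_on_def\<close>)
    finally show ?thesis by (simp only: C.emeasure_eq_measure qm)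
  qed
  then show ?thesis using nn_integral_nat_function[OF l] by simp
qed

end

section \<open>The characterization\<close>

theorem corollary2:
  fixes M :: "'w measure" and A :: "'a set" and X :: "int \<Rightarrow> 'w \<Rightarrow> 'a"
  assumes "finite A"
    and "stationary_process M (count_space A) X"
    and "uniform_martingale M A X"
  shows "deterministic_random_step_markov M A X \<and>
    (has_finite_expected_lookback_representation M A X \<longleftrightarrow> (\<Sum>n. variation M A X n) < \<infinity>)"
proof -
  let ?Z = "\<lambda>i (\<omega>::int \<Rightarrow> 'a). \<omega> i"
  have M: "prob_space M" and X: "\<And>i. X i \<in> measurable M (count_space A)"
    and shiftX: "\<And>k. process_law M (count_space A) (\<lambda>i. X (i + k)) = process_law M (count_space A) X"
    using assms(2) unfolding stationary_process_def by blast+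
  define P where "P = process_law M (count_space A) X"
  have sets_P: "sets P = sets (\<Pi>\<^sub>M i\<in>UNIV. count_space A)" by (simp add: P_def process_law_def)
  interpret M: prob_space M by fact
  interpret P: prob_space P unfolding P_def by (rule prob_space_process_law[OF M X])
  have Z: "?Z i \<in> measurable P (count_space A)" for i
    unfolding measurable_cong_sets[OF sets_P refl] by simp
  obtain w where "w \<in> space M" using M.not_empty by auto
  from measurable_space[OF X[of 0] this] have ne: "A \<noteq> {}" by auto
  have shift: "distr P P (\<lambda>\<omega> i. \<omega> (i + k)) = P" for k
  proof -
    let ?S = "\<Pi>\<^sub>M i\<in>(UNIV::int set). count_space A"
    have s: "(\<lambda>\<omega> i. \<omega> (i + k)) \<in> measurable ?S ?S"
      by (rule measurable_path[where X="\<lambda>i \<omega>. \<omega> (i + k)"]) simp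
    have "distr P P (\<lambda>\<omega> i. \<omega> (i + k)) = distr P ?S (\<lambda>\<omega> i. \<omega> (i + k))"
      by (rule distr_cong) (simp_all add: sets_P)
    also have "\<dots> = distr M ?S (\<lambda>w i. X (i + k) w)"
      unfolding P_def process_law_def by (subst distr_distr[OF s measurable_path[OF X]]) (simp add: comp_def)
    also have "\<dots> = P" using shiftX[of k] by (simp add: P_def process_law_def)
    finally show ?thesis .
  qed
  \<comment> \<open>Distance 0 is not allowed: the value \<open>v 0 = 1\<close> makes the minimum at
    the first stage equal to 1, so that \<open>q 0 = 0\<close>. It still bounds the error of the
    estimate at stage 0, a difference of two probabilities.\<close>
  define v where "v n = (if n = 0 then 1 else enn2real (variation M A X n))" for n
  define q where "q n = lookback_tail (1 / card A) v n - lookback_tail (1 / card A) v (Suc n)" for n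
  define \<pi> where "\<pi> n \<omega> a = cond_law P A ?Z (recent_past n) \<omega> {a}" for n \<omega> a
  define f where "f = greedy_letter A q \<pi>"
  have c: "0 < 1 / real (card A)" "1 / real (card A) \<le> 1"
    using assms(1) ne by (auto simp: Suc_le_eq card_gt_0_iff)
  \<comment> \<open>All variations are finite, so passing to real numbers with
    \<open>enn2real\<close> loses nothing.\<close>
  have var1: "variation M A X n \<le> ennreal 1" for n
  proof (rule variation_leI)
    fix a assume a: "a \<in> A"
    from cond_law_bounds[where X=X, OF M X a, of "recent_past n"] cond_law_bounds[where X=X, OF M X a, of all_past]
    show "AE w in M. \<bar>cond_law M A X (recent_past n) w {a} - cond_law M A X all_past w {a}\<bar> \<le> 1"
      by eventually_elim auto
  qed
  then have varv: "variation M A X n = ennreal (enn2real (variation M A X n))" for n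
    by (metis ennreal_enn2real ennreal_less_top order_le_less_trans)
  have v0: "0 \<le> v n" for n by (simp add: v_def)
  have "(\<lambda>n. enn2real (variation M A X n)) \<longlonglongrightarrow> 0"
    using uniform_martingale_variation_tendsto_0[OF assms(1,3)] by (intro tendsto_enn2real) simp_all
  then have v: "v \<longlonglongrightarrow> 0"
    by (rule Lim_transform_eventually) (auto simp: v_def eventually_sequentially intro!: exI[of _ 1])
  have bound: "AE \<omega> in P. \<bar>\<pi> n \<omega> a - cond_law P A ?Z all_past \<omega> {a}\<bar> \<le> v n" if a: "a \<in> A" for n a
  proof (cases "n = 0")
    case True
    from cond_law_bounds[where X="?Z", OF P.prob_space_axioms Z a, of "recent_past n"]
      cond_law_bounds[where X="?Z", OF P.prob_space_axioms Z a, of all_past]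
    show ?thesis by eventually_elim (use True in \<open>auto simp: \<pi>_def v_def\<close>)
  next
    case False
    have "AE w in M. \<bar>cond_law M A X (recent_past n) w {a} - cond_law M A X all_past w {a}\<bar> \<le> v n"
      using esssup_AE[of "\<lambda>w. ennreal \<bar>cond_law M A X (recent_past n) w {a} - cond_law M A X all_past w {a}\<bar>" M]
    proof eventually_elim
      case (elim w)
      also have "esssup M (\<lambda>w. ennreal \<bar>cond_law M A X (recent_past n) w {a} - cond_law M A X all_past w {a}\<bar>) \<le> variation M A X n"
        unfolding variation_def by (rule SUP_upper) fact
      also have "\<dots> = ennreal (v n)" using varv[of n] False by (simp add: v_def)
      finally show ?case using v0 by (simp add: ennreal_le_iff)
    qed
    then show ?thesis unfolding AE_cond_law_process_law[OF M X] P_def[symmetric] \<pi>_def .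
  qed
  have f_meas: "f n \<in> measurable (vimage_algebra (space P) (block ?Z (recent_past n)) (block_space A (recent_past n))) (count_space A)" for n
    unfolding f_def
  proof (rule measurable_greedy[OF assms(1) ne])
    show "subalgebra (vimage_algebra (space P) (block ?Z (recent_past (Suc n))) (block_space A (recent_past (Suc n))))
      (vimage_algebra (space P) (block ?Z (recent_past n)) (block_space A (recent_past n)))" for n
      by (rule subalgebra_block) (auto intro: Z)
    show "(\<lambda>\<omega>. \<pi> n \<omega> a) \<in> borel_measurable (vimage_algebra (space P) (block ?Z (recent_past n)) (block_space A (recent_past n)))" for n a
      unfolding \<pi>_def cond_law_def cond_prob_given_def by (rule borel_measurable_cond_exp)
  qed
  \<comment> \<open>Countably many stages and finitely many letters allow a single exceptional null
    set, outside which the greedy splitting runs path by path.\<close>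
  have "AE \<omega> in P. (\<forall>n. \<forall>a\<in>A. \<bar>\<pi> n \<omega> a - cond_law P A ?Z all_past \<omega> {a}\<bar> \<le> v n) \<and> (\<forall>n. (\<Sum>a\<in>A. \<pi> n \<omega> a) = 1)"
    using bound sum_cond_law[where X="?Z", OF P.prob_space_axioms Z assms(1)]
    unfolding \<pi>_def by (intro AE_conjI AE_all_countable[THEN iffD2] AE_finite_allI allI assms(1))
  moreover have "AE \<omega> in P. \<forall>a\<in>A. 0 \<le> cond_law P A ?Z all_past \<omega> {a}"
  proof (rule AE_finite_allI[OF assms(1)])
    show "AE \<omega> in P. 0 \<le> cond_law P A ?Z all_past \<omega> {a}" if "a \<in> A" for a
      using cond_law_bounds[where X="?Z", OF P.prob_space_axioms Z that, of all_past] by eventually_elim simp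
  qed
  moreover have "AE \<omega> in P. (\<Sum>a\<in>A. cond_law P A ?Z all_past \<omega> {a}) = 1"
    by (rule sum_cond_law[where X="?Z", OF P.prob_space_axioms Z assms(1)])
  ultimately have mass: "AE \<omega> in P. \<forall>a\<in>A. (\<lambda>n. q n * of_bool (f n \<omega> = a)) sums cond_law P A ?Z all_past \<omega> {a}"
  proof eventually_elim
    case (elim \<omega>)
    show ?case
      unfolding f_def q_def
      by (intro ballI greedy_mass_limit[OF assms(1) ne v0 v]) (use elim in auto)
  qed
  have tail: "(\<Sum>m<n. q m) = 1 - lookback_tail (1 / card A) v n" for n
    unfolding q_def by (subst sum_lessThan_telescope') simp
  interpret step_law P A q f
  proof (intro step_law.intro P.prob_space_axioms step_law_axioms.intro assms(1) sets_P shift f_meas mass)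
    show "0 \<le> q n" for n by (simp add: q_def)
    show "q 0 = 0" using c by (simp add: q_def v_def)
    have "(\<lambda>n. 1 - lookback_tail (1 / card A) v n) \<longlonglongrightarrow> 1 - 0"
      by (intro tendsto_intros lookback_tail_tendsto_0 c v0 v)
    then show "q sums 1" by (simp add: sums_def tail)
  qed
  have rep: "deterministic_representation M A X coupling (\<lambda>i v. fst v i) (\<lambda>i v. snd v i)"
    by (rule coupling_representation[OF assms(2)]) (simp add: P_def)
  show ?thesis
  proof (intro conjI iffI)
    show "deterministic_random_step_markov M A X"
      using rep unfolding deterministic_random_step_markov_def by blast
  next
    assume "has_finite_expected_lookback_representation M A X"
    then show "(\<Sum>n. variation M A X n) < \<infinity>"
      unfolding has_finite_expected_lookback_representation_def
      using summable_variation_if_finite_expected_lookback by blast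
  next
    assume "(\<Sum>n. variation M A X n) < \<infinity>"
    then have "(\<Sum>n. ennreal (enn2real (variation M A X n))) \<noteq> top" by (simp flip: varv)
    then have "summable (\<lambda>n. enn2real (variation M A X n))"
      by (rule summable_suminf_not_top[rotated]) simp
    then have "summable v"
      by (rule summable_cong[THEN iffD1, rotated]) (auto simp: v_def eventually_sequentially intro!: exI[of _ 1])
    then have s: "summable (lookback_tail (1 / card A) v)"
      by (rule summable_lookback_tail[OF c v0])
    \<comment> \<open>The distance exceeds \<open>n\<close> with probability 1 minus the masses of
      the stages up to and including \<open>n\<close>, which is the unassigned mass at
      \<open>Suc n\<close>.\<close>
    have "(\<integral>\<^sup>+ v. of_nat (snd v 0) \<partial>coupling) = (\<Sum>n. ennreal (lookback_tail (1 / card A) v (Suc n)))"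
      unfolding expected_lookback_coupling tail by simp
    also have "\<dots> < top"
      using s lookback_tail_nonneg[OF c v0] by (subst suminf_ennreal2) (simp_all add: summable_Suc_iff del: lookback_tail.simps)
    finally have "finite_expected_lookback coupling (\<lambda>i v. snd v i)"
      by (simp add: finite_expected_lookback_def)
    with rep show "has_finite_expected_lookback_representation M A X"
      unfolding has_finite_expected_lookback_representation_def deterministic_representation_def by blast
  qed
qed

end
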